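(* If the matrix $M$ is anisotropic (i.e. its eigenvalues are not all equal in absolute value) and the refinable function $\varphi\neq0$ is Lipschitz continuous, then $$1=\alpha_\varphi>\log_{1/\rho(M)}\rho(\mathcal{A})$$ and the family $\mathcal{A}$ is reducible, i.e. the operators $A_d$, $d\in D(M)$, possess a common nontrivial invariant subspace of $U$.
   Context: Setting. $M\in\mathbb{Z}^{s\times s}$ is an expansive integer matrix (all its eigenvalues are larger than $1$ in absolute value), $m=|\det M|\ge 2$, and $\rho(M)$ is its spectral radius. $D(M)=\{d_0,\ldots,d_{m-1}\}\subset\mathbb{Z}^s$ is a complete set of representatives of $\mathbb{Z}^s/M\mathbb{Z}^s$ with $0\in D(M)$. $G=\{\sum_{i\ge1}M^{-i}d_i : d_i\in D(M)\}$ is assumed to be a tile, i.e. $\mu(G)=1$ (Lebesgue measure), so the sets $k+G$, $k\in\mathbb{Z}^s$, cover $\mathbb{R}^s$ with overlaps of measure zero. $c=(c_k)_{k\in\mathbb{Z}^s}$ is a finitely supported real sequence with $\sum_{k\in\mathbb{Z}^s}c_{Mk-d}=1$ for all $d\in D(M)$. The refinable function $\varphi$ is the compactly supported distribution on $\mathbb{R}^s$ with $\varphi(x)=\sum_{k\in\mathbb{Z}^s}c_k\,\varphi(Mx-k)$ and $\int\varphi=1$. Let $K=\{\sum_{j\ge1}M^{-j}\gamma_j:\gamma_j\in\mathrm{supp}(c)\}$ (then $\mathrm{supp}\,\varphi\subseteq K$), $\Omega\subset\mathbb{Z}^s$ a finite minimal set with $K\subseteq\Omega+G$, $N=|\Omega|$.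 The transition matrices are $(T_d)_{ab}=c_{Ma-b+d}$, $a,b\in\Omega$, $d\in D(M)$. For continuous $\varphi$, $v:G\to\mathbb{R}^N$, $v(x)=(\varphi(x+k))_{k\in\Omega}$; $U=\mathrm{span}\{v(y)-v(x):x,y\in G\}$, which is invariant under all $T_d$; and $\mathcal{A}=\{A_d=T_d|_U:d\in D(M)\}$. The joint spectral radius of a finite family is $\rho(\mathcal{A})=\lim_{k\to\infty}\max_{A_{d_j}\in\mathcal{A}}\|A_{d_1}\cdots A_{d_k}\|^{1/k}$. The Hölder exponent is $\alpha_\varphi=\sup\{\alpha\ge0:\exists C\ \forall h\in\mathbb{R}^s\ \|\varphi(\cdot+h)-\varphi\|_{C(\mathbb{R}^s)}\le C\|h\|^\alpha\}$. Here $\log_{1/r}\rho=-\ln\rho/\ln r$. *)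

theory Defs
  imports "HOL-Analysis.Analysis"
begin

definition real_vec :: "int ^ 's \<Rightarrow> real ^ 's" where
  "real_vec k = (\<chi> i. real_of_int (k $ i))"

definition real_mat :: "int ^ 's ^ 's \<Rightarrow> real ^ 's ^ 's" where
  "real_mat M = map_matrix real_of_int M"

definition eigenvalues :: "int ^ 's ^ 's \<Rightarrow> complex set" where
  "eigenvalues M =
     {z. \<exists>u :: complex ^ 's. u \<noteq> 0 \<and> map_matrix of_int M *v u = z *s u}"

definition spectral_radius :: "int ^ 's ^ 's \<Rightarrow> real" where
  "spectral_radius M = Sup (cmod ` eigenvalues M)"

definition expansive :: "int ^ 's ^ 's \<Rightarrow> bool" where
  "expansive M \<longleftrightarrow> (\<forall>z \<in> eigenvalues M. cmod z > 1)"

definition anisotropic :: "int ^ 's ^ 's \<Rightarrow> bool" where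
  "anisotropic M \<longleftrightarrow> (\<exists>z \<in> eigenvalues M. \<exists>w \<in> eigenvalues M. cmod z \<noteq> cmod w)"

definition complete_digits :: "int ^ 's ^ 's \<Rightarrow> (int ^ 's) set \<Rightarrow> bool" where
  "complete_digits M D \<longleftrightarrow> (\<forall>x. \<exists>!d. d \<in> D \<and> (\<exists>y. x - d = M *v y))"

(* Iterated maps are used for the powers of the inverse matrix, since the library's power
   operation on the vector type is componentwise.  The index i starts at 0, hence Suc i. *)
definition digit_attractor :: "int ^ 's ^ 's \<Rightarrow> (int ^ 's) set \<Rightarrow> (real ^ 's) set" where
  "digit_attractor M S =
     {x. \<exists>\<gamma>. (\<forall>i::nat. \<gamma> i \<in> S) \<and>
             (\<lambda>i. (((*v) (matrix_inv (real_mat M))) ^^ Suc i) (real_vec (\<gamma> i))) sums x}"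

definition seq_supp :: "(int ^ 's \<Rightarrow> real) \<Rightarrow> (int ^ 's) set" where
  "seq_supp c = {k. c k \<noteq> 0}"

(* The summation range is the set of all k giving a nonzero term. *)
definition sum_rule :: "int ^ 's ^ 's \<Rightarrow> (int ^ 's) set \<Rightarrow> (int ^ 's \<Rightarrow> real) \<Rightarrow> bool" where
  "sum_rule M D c \<longleftrightarrow>
     (\<forall>d \<in> D. (\<Sum>k | M *v k - d \<in> seq_supp c. c (M *v k - d)) = 1)"

(* The compactly supported normalised solution of the refinement equation, in the case where
   this distribution is a continuous function: the equation then holds at every point. *)
definition refinable_function ::
  "int ^ 's ^ 's \<Rightarrow> (int ^ 's \<Rightarrow> real) \<Rightarrow> (real ^ 's \<Rightarrow> real) \<Rightarrow> bool" where
  "refinable_function M c \<phi> \<longleftrightarrow>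
     continuous_on UNIV \<phi> \<and>
     compact (closure {x. \<phi> x \<noteq> 0}) \<and>
     (\<forall>x. \<phi> x = (\<Sum>k \<in> seq_supp c. c k * \<phi> (real_mat M *v x - real_vec k))) \<and>
     (LINT x|lborel. \<phi> x) = 1"

definition translates :: "(int ^ 's) set \<Rightarrow> (real ^ 's) set \<Rightarrow> (real ^ 's) set" where
  "translates \<Omega> G = (\<Union>k\<in>\<Omega>. (\<lambda>x. real_vec k + x) ` G)"

definition minimal_cover ::
  "(real ^ 's) set \<Rightarrow> (real ^ 's) set \<Rightarrow> (int ^ 's) set \<Rightarrow> bool" where
  "minimal_cover K G \<Omega> \<longleftrightarrow>
     finite \<Omega> \<and> K \<subseteq> translates \<Omega> G \<and> (\<forall>\<Omega>'. \<Omega>' \<subset> \<Omega> \<longrightarrow> \<not> K \<subseteq> translates \<Omega>' G)"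

(* In the following, the finite set Omega is given by an enumeration \<omega> without repetitions,
   so that R^N with N = |Omega| is the type real ^ 'n. *)
definition transition_matrix ::
  "int ^ 's ^ 's \<Rightarrow> (int ^ 's \<Rightarrow> real) \<Rightarrow> ('n \<Rightarrow> int ^ 's) \<Rightarrow> int ^ 's \<Rightarrow> real ^ 'n ^ 'n" where
  "transition_matrix M c \<omega> d = (\<chi> a b. c (M *v \<omega> a - \<omega> b + d))"

definition shift_vector ::
  "(real ^ 's \<Rightarrow> real) \<Rightarrow> ('n \<Rightarrow> int ^ 's) \<Rightarrow> real ^ 's \<Rightarrow> real ^ 'n" where
  "shift_vector \<phi> \<omega> x = (\<chi> a. \<phi> (x + real_vec (\<omega> a)))"

definition difference_space ::
  "(real ^ 's) set \<Rightarrow> (real ^ 's \<Rightarrow> real) \<Rightarrow> ('n \<Rightarrow> int ^ 's) \<Rightarrow> (real ^ 'n) set" where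
  "difference_space G \<phi> \<omega> =
     span {shift_vector \<phi> \<omega> y - shift_vector \<phi> \<omega> x | x y. x \<in> G \<and> y \<in> G}"

(* A family of operators on a subspace U is represented by operators on the whole space that
   leave U invariant; the restriction to U enters through the norm below. *)
definition norm_on :: "'a::real_normed_vector set \<Rightarrow> ('a \<Rightarrow> 'a) \<Rightarrow> real" where
  "norm_on U f = (SUP x \<in> {x \<in> U. norm x \<le> 1}. norm (f x))"

definition joint_spectral_radius ::
  "'a::real_normed_vector set \<Rightarrow> ('a \<Rightarrow> 'a) set \<Rightarrow> real" where
  "joint_spectral_radius U \<A> =
     lim (\<lambda>k. Max {root k (norm_on U (foldr (\<circ>) As id)) | As. length As = k \<and> set As \<subseteq> \<A>})"

definition reducible_on :: "'a::real_vector set \<Rightarrow> ('a \<Rightarrow> 'a) set \<Rightarrow> bool" where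
  "reducible_on U \<A> \<longleftrightarrow>
     (\<exists>W. subspace W \<and> W \<subseteq> U \<and> W \<noteq> {0} \<and> W \<noteq> U \<and> (\<forall>A \<in> \<A>. A ` W \<subseteq> W))"

definition holder_exponent :: "('a::real_normed_vector \<Rightarrow> real) \<Rightarrow> ereal" where
  "holder_exponent \<phi> =
     Sup {ereal \<alpha> | \<alpha>. \<alpha> \<ge> 0 \<and> (\<exists>C. \<forall>h x. \<bar>\<phi> (x + h) - \<phi> x\<bar> \<le> C * norm h powr \<alpha>)}"

(* Logarithm of p to the base 1/r for r > 1 and p \<ge> 0.  The value at p = 0 is infinite, which
   the total function ln (with ln 0 = 0) would not give. *)
definition log_recip :: "real \<Rightarrow> real \<Rightarrow> ereal" where
  "log_recip r p = (if p = 0 then \<infinity> else ereal (- ln p / ln r))"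

end

theory Submission
  imports Defs "HOL-Computational_Algebra.Fundamental_Theorem_Algebra"
begin

text \<open>The shift vector v(x) collects the values of \<phi> at the points x + \<omega> a. On the tile G the refinement
equation becomes v(M^(-1)(x + d)) = T_d v(x), so a product of n transition matrices maps
v(y) - v(x) to the difference of v at two points whose distance vector is M^(-n)(y - x). The
spectral radius \<rho> of the family therefore says how fast \<phi> varies over displacements of the form
M^(-n) h. The rate at which the length of such a displacement shrinks depends on the direction of h:
it is 1/|\<mu>| if h comes from an eigenvector for the eigenvalue \<mu>.

Slow directions force \<rho> to be large (lemma joint_spectral_radius_ge). If \<rho> < 1/|\<mu>|, choose \<eta>
between the two. A fixed displacement h in the eigendirections of \<mu> can be split into about |\<mu>|^n equal
steps, each of the form M^(-n) s with s bounded, and over each of them \<phi> changes by O(\<eta>^n). So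
\<phi>(x + h) - \<phi>(x) is O((|\<mu>| \<eta>)^n) for all n, hence 0; and a function with bounded support and a
nonzero period vanishes. Therefore \<rho> \<ge> 1/|\<mu>| for every eigenvalue \<mu>.

Fast directions give the invariant subspace. Let W be spanned by the differences v(y) - v(x) with
y - x in the eigendirections of \<mu>. It is invariant because M^(-1) preserves these directions, and it
is not {0}, since otherwise \<phi> would again be periodic (lemma directional_span_nonzero). If W = U, then
the Lipschitz condition bounds the products of length n by a constant times |\<mu>|^(-n), so that
\<rho> \<le> 1/|\<mu>| (lemma joint_spectral_radius_le_if_directional).

An anisotropic M has eigenvalues z and w with |z| < |w| \<le> \<rho>(M). The first part gives
\<rho> \<ge> 1/|z| > 1/|w| \<ge> 1/\<rho>(M), which is the strict inequality, and then W for the eigenvalue w is different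
from U. The value 1 of the Hoelder exponent holds for every nonzero Lipschitz function with bounded
support.

Three facts about the setting carry this argument. Powers of M^(-1) contract, which is derived from
the eigenvalue condition. The translates of G by lattice vectors cover the space with negligible
overlaps, so that a translate which is not indexed by \<omega> cannot meet the set where \<phi> is nonzero. And a
segment of bounded length meets a bounded number of tiles, which transfers estimates within a tile to
arbitrary pairs of points.\<close>

section \<open>Contraction by the inverse of an expansive matrix\<close>

text \<open>The vector p(A) x, computed by Horner's scheme on vectors: with the componentwise product of the
vector type, A ^ i would not be a matrix power.\<close>

definition poly_act :: "complex ^ 'n ^ 'n \<Rightarrow> complex poly \<Rightarrow> complex ^ 'n \<Rightarrow> complex ^ 'n" where
  "poly_act A p x = fold_coeffs (\<lambda>a y. a *s x + A *v y) p 0"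

lemma poly_act_0 [simp]: "poly_act A 0 x = 0"
  by (simp add: poly_act_def)

lemma poly_act_pCons [simp]: "poly_act A (pCons a p) x = a *s x + A *v poly_act A p x"
  by (cases "p = 0 \<and> a = 0") (auto simp: poly_act_def)

lemma poly_act_add: "poly_act A (p + q) x = poly_act A p x + poly_act A q x"
  by (induction p q rule: poly_induct2)
     (simp_all add: vec.scale_left_distrib matrix_vector_right_distrib algebra_simps)

lemma poly_act_smult: "poly_act A (smult a p) x = a *s poly_act A p x"
  by (induction p) (simp_all add: vec.scale_right_distrib vec.scale mult.commute)

lemma poly_act_sum: "poly_act A (sum p I) x = (\<Sum>i\<in>I. poly_act A (p i) x)"
  by (induction I rule: infinite_finite_induct) (simp_all add: poly_act_add)

lemma poly_act_monom: "poly_act A (monom a i) x = a *s (((*v) A) ^^ i) x"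
  by (induction i) (simp_all add: monom_0 monom_Suc vec.scale)

lemma poly_act_shift:
  "poly_act A p (A *v x - z *s x) = A *v poly_act A p x - z *s poly_act A p x"
  by (induction p)
     (simp_all add: vec.scale vec.scale_right_distrib vec.scale_right_diff_distrib
        matrix_vector_right_distrib matrix_vector_mult_diff_distrib mult.commute)

text \<open>A root z of an annihilating polynomial lowers the degree: if (X - z) q annihilates x, then q
annihilates (A - z) x.\<close>

lemma poly_act_linear_factor:
  "poly_act A ([:- z, 1:] * q) x = poly_act A q (A *v x - z *s x)"
proof -
  have "[:- z, 1:] * q = pCons 0 q + smult (- z) q"
    by simp
  then show ?thesis
    by (simp only: poly_act_shift poly_act_add poly_act_smult poly_act_pCons) simp
qed

text \<open>More vectors of the orbit of x than the real dimension of the space either repeat or are linearly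
dependent, and the coefficients of a dependency are those of an annihilating polynomial.\<close>

lemma exists_annihilating_poly:
  fixes A :: "complex ^ 'n ^ 'n"
  shows "\<exists>p. p \<noteq> 0 \<and> poly_act A p x = 0"
proof -
  define f where "f i = (((*v) A) ^^ i) x" for i
  \<comment> \<open>the real dimension; real coefficients are as good as complex ones here\<close>
  define m where "m = DIM(complex ^ 'n)"
  show ?thesis
  proof (cases "inj_on f {..m}")
    case True
    then have "card (f ` {..m}) > DIM(complex ^ 'n)"
      by (simp add: card_image m_def)
    then have "dependent (f ` {..m})"
      using dependent_biggerset by blast
    then obtain u where u: "\<exists>v\<in>f ` {..m}. u v \<noteq> 0" "(\<Sum>v\<in>f ` {..m}. u v *\<^sub>R v) = 0"
      by (subst (asm) dependent_finite) auto
    define p where "p = (\<Sum>i\<le>m. monom (of_real (u (f i)) :: complex) i)"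
    have "(\<Sum>v\<in>f ` {..m}. u v *\<^sub>R v) = (\<Sum>i\<le>m. u (f i) *\<^sub>R f i)"
      by (rule sum.reindex_cong[OF True]) auto
    moreover have "complex_of_real a *s v = a *\<^sub>R v" for a and v :: "complex ^ 'n"
      by (simp add: vec_eq_iff scaleR_conv_of_real[where 'a = complex])
    ultimately have "poly_act A p x = 0"
      using u(2) by (simp add: p_def poly_act_sum poly_act_monom f_def)
    moreover obtain i where i: "i \<le> m" "u (f i) \<noteq> 0"
      using u(1) by auto
    have "coeff p i = of_real (u (f i))"
      using i by (simp add: p_def coeff_sum)
    then have "p \<noteq> 0"
      using i by auto
    ultimately show ?thesis by blast
  next
    case False
    then obtain i j where ij: "i \<noteq> j" "f i = f j"
      by (auto simp: inj_on_def)
    \<comment> \<open>a repeated vector of the orbit is annihilated by X^i - X^j\<close>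
    define p where "p = monom 1 i + monom (-1 :: complex) j"
    have "coeff p i \<noteq> 0"
      using ij by (simp add: p_def)
    then have "p \<noteq> 0" by auto
    moreover have "poly_act A p x = 0"
      using ij by (simp add: p_def poly_act_add poly_act_monom f_def)
    ultimately show ?thesis by blast
  qed
qed

lemma summable_recurrence:
  fixes a b :: "nat \<Rightarrow> real"
  assumes "\<And>n. a n \<ge> 0" "\<And>n. a (Suc n) \<le> r * a n + b n" "0 \<le> r" "r < 1"
    and "summable b" "\<And>n. b n \<ge> 0"
  shows "summable a"
proof (rule summableI_nonneg_bounded)
  show "0 \<le> a n" for n by fact
  fix n
  \<comment> \<open>bound the partial sums by summing the recurrence and absorbing r times the sum on the left\<close>
  have mono: "sum a {..<n} \<le> sum a {..<Suc n}"
    using assms(1) by simp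
  have "sum a {..<Suc n} = a 0 + (\<Sum>i<n. a (Suc i))"
    by (rule sum.lessThan_Suc_shift)
  also have "\<dots> \<le> a 0 + (\<Sum>i<n. r * a i + b i)"
    by (intro add_left_mono sum_mono assms)
  also have "\<dots> = a 0 + r * sum a {..<n} + sum b {..<n}"
    by (simp add: sum.distrib sum_distrib_left)
  also have "\<dots> \<le> a 0 + r * sum a {..<n} + suminf b"
    using sum_le_suminf[OF assms(5)] assms(6) by simp
  finally have "(1 - r) * sum a {..<n} \<le> a 0 + suminf b"
    using mono by (simp add: algebra_simps)
  then show "sum a {..<n} \<le> (a 0 + suminf b) / (1 - r)"
    using assms(4) by (simp add: field_simps)
qed

lemma norm_vector_scale_complex: "norm (z *s (x :: complex ^ 'n)) = cmod z * norm x"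
proof -
  have "norm (z *s x) = L2_set (\<lambda>i. cmod z * norm (x $ i)) UNIV"
    by (simp add: norm_vec_def norm_mult)
  then show ?thesis
    by (simp add: norm_vec_def L2_set_right_distrib)
qed

text \<open>Write p = (X - z) q and y = (A - z) x; the orbit of y is summable by induction on the degree. If
|z| < 1, the recurrence A^(n+1) x = z A^n x + A^n y makes the orbit of x summable. Otherwise z is not an
eigenvalue, so q already annihilates x. This replaces the Jordan normal form.\<close>

lemma summable_orbit_if_annihilated:
  fixes A :: "complex ^ 'n ^ 'n"
  assumes eig: "\<And>z u. u \<noteq> 0 \<Longrightarrow> A *v u = z *s u \<Longrightarrow> cmod z < 1"
    and "p \<noteq> 0" "poly_act A p x = 0"
  shows "summable (\<lambda>n. norm ((((*v) A) ^^ n) x))"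
  using assms(2,3)
proof (induction "degree p" arbitrary: p x)
  case 0
  then obtain a where "p = [:a:]" "a \<noteq> 0"
    by (metis degree_eq_zeroE pCons_0_0)
  with 0 have "x = 0" by simp
  moreover have "(((*v) A) ^^ n) 0 = 0" for n
    by (induction n) auto
  ultimately show ?case by simp
next
  case (Suc k)
  then have "\<not> constant (poly p)"
    by (simp add: constant_degree)
  then obtain z where "poly p z = 0"
    using fundamental_theorem_of_algebra by blast
  then obtain q where q: "p = [:- z, 1:] * q"
    using poly_eq_0_iff_dvd by (metis dvdE)
  then have "q \<noteq> 0" using Suc by auto
  then have deg: "k = degree q"
    using Suc(2) q degree_mult_eq[of "[:- z, 1:]" q] by simp
  define y where "y = A *v x - z *s x"
  have y: "poly_act A q y = 0"
    using Suc(4) q y_def poly_act_linear_factor by metis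
  have sy: "summable (\<lambda>n. norm ((((*v) A) ^^ n) y))"
    by (rule Suc(1)[OF deg \<open>q \<noteq> 0\<close> y])
  show ?case
  proof (cases "cmod z < 1")
    case True
    have rec: "(((*v) A) ^^ Suc n) x = z *s (((*v) A) ^^ n) x + (((*v) A) ^^ n) y" for n
    proof (induction n)
      case (Suc n)
      then have "A *v (((*v) A) ^^ Suc n) x = A *v (z *s (((*v) A) ^^ n) x + (((*v) A) ^^ n) y)"
        by (rule arg_cong)
      then show ?case
        by (simp add: vec.scale matrix_vector_right_distrib)
    qed (simp add: y_def)
    have step: "norm ((((*v) A) ^^ Suc n) x)
            \<le> cmod z * norm ((((*v) A) ^^ n) x) + norm ((((*v) A) ^^ n) y)" for n
      unfolding rec by (metis norm_triangle_ineq norm_vector_scale_complex)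
    show ?thesis
      by (rule summable_recurrence[OF _ step _ _ sy]) (use True in simp_all)
  next
    case False
    have "A *v poly_act A q x = z *s poly_act A q x"
      using y by (simp add: y_def poly_act_shift)
    then have "poly_act A q x = 0"
      using eig False by blast
    then show ?thesis
      using Suc(1)[OF deg \<open>q \<noteq> 0\<close>] by blast
  qed
qed

lemma real_mat_inverse:
  assumes "det (M :: int ^ 's ^ 's) \<noteq> 0"
  shows "real_mat M ** matrix_inv (real_mat M) = mat 1"
        "matrix_inv (real_mat M) ** real_mat M = mat 1"
proof -
  have "det (real_mat M) = real_of_int (det M)"
    by (simp add: real_mat_def det_def)
  then have "invertible (real_mat M)"
    using assms by (simp add: invertible_det_nz)
  then show "real_mat M ** matrix_inv (real_mat M) = mat 1"
        "matrix_inv (real_mat M) ** real_mat M = mat 1"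
    unfolding invertible_def matrix_inv_def by (metis (mono_tags, lifting) someI_ex)+
qed

definition complex_vec :: "real ^ 's \<Rightarrow> complex ^ 's" where
  "complex_vec x = (\<chi> i. of_real (x $ i))"

definition Re_vec :: "complex ^ 's \<Rightarrow> real ^ 's" where
  "Re_vec u = (\<chi> i. Re (u $ i))"

lemma complexified_inverse:
  assumes "det (M :: int ^ 's ^ 's) \<noteq> 0"
  defines "A \<equiv> map_matrix complex_of_real (matrix_inv (real_mat M))"
  shows "map_matrix of_int M ** A = mat 1" "A ** map_matrix of_int M = mat 1"
proof -
  have eq: "map_matrix of_int M = map_matrix complex_of_real (real_mat M)"
    by (simp add: vec_eq_iff real_mat_def)
  have mm: "map_matrix complex_of_real X ** map_matrix complex_of_real Y
              = map_matrix complex_of_real (X ** Y)" for X Y :: "real ^ 's ^ 's"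
    by (simp add: vec_eq_iff matrix_matrix_mult_def)
  have id: "map_matrix complex_of_real (mat 1 :: real ^ 's ^ 's) = mat 1"
    by (simp add: vec_eq_iff mat_def)
  show "map_matrix of_int M ** A = mat 1" "A ** map_matrix of_int M = mat 1"
    by (simp_all add: eq A_def mm id real_mat_inverse[OF assms(1)])
qed

text \<open>The eigenvalues of the complexified inverse are the reciprocals of those of M, hence lie in the open
unit disc.\<close>

lemma summable_inverse_orbit:
  fixes M :: "int ^ 's ^ 's"
  assumes "expansive M" "det M \<noteq> 0"
  shows "summable (\<lambda>n. norm ((((*v) (matrix_inv (real_mat M))) ^^ n) x))"
proof -
  define B where "B = matrix_inv (real_mat M)"
  define A where "A = map_matrix complex_of_real B"
  define C :: "complex ^ 's ^ 's" where "C = map_matrix of_int M"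
  have CA: "C ** A = mat 1"
    using complexified_inverse[OF assms(2)] by (simp add: A_def B_def C_def)
  have eig: "cmod z < 1" if "u \<noteq> 0" "A *v u = z *s u" for z u
  proof -
    have u: "u = z *s (C *v u)"
      using CA that by (metis matrix_vector_mul_assoc matrix_vector_mul_lid vec.scale)
    then have "z \<noteq> 0" using that by auto
    then have "C *v u = inverse z *s u"
      using u by (metis vec.scale_scale left_inverse vec.scale_one)
    then have "cmod (inverse z) > 1"
      using assms(1) that(1) unfolding expansive_def eigenvalues_def C_def by blast
    then show "cmod z < 1"
      using \<open>z \<noteq> 0\<close> by (simp add: norm_inverse one_less_inverse_iff)
  qed
  have "(((*v) A) ^^ n) (complex_vec x) = complex_vec ((((*v) B) ^^ n) x)" for n
    by (induction n) (simp_all add: complex_vec_def A_def vec_eq_iff matrix_vector_mult_def)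
  moreover have "norm (complex_vec y) = norm y" for y :: "real ^ 's"
    by (simp add: complex_vec_def norm_vec_def)
  moreover obtain p where "p \<noteq> 0" "poly_act A p (complex_vec x) = 0"
    using exists_annihilating_poly by blast
  then have "summable (\<lambda>n. norm ((((*v) A) ^^ n) (complex_vec x)))"
    using summable_orbit_if_annihilated eig by blast
  ultimately show ?thesis
    by (simp add: B_def)
qed

text \<open>A complex eigenvector spans, through real parts, an invariant real subspace of dimension at most two
on which the powers of the inverse shrink exactly at the rate of the eigenvalue.\<close>

lemma inverse_orbit_Re_eigenvector:
  fixes M :: "int ^ 's ^ 's"
  assumes "det M \<noteq> 0" "\<mu> \<noteq> 0" "map_matrix of_int M *v u = \<mu> *s u"
  shows "(((*v) (matrix_inv (real_mat M))) ^^ n) (Re_vec (w *s u)) = Re_vec ((w / \<mu> ^ n) *s u)"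
proof (induction n)
  case (Suc n)
  let ?B = "matrix_inv (real_mat M)"
  let ?A = "map_matrix complex_of_real ?B"
  have "?A *v (map_matrix of_int M *v u) = u"
    by (simp add: matrix_vector_mul_assoc complexified_inverse[OF assms(1)])
  then have "\<mu> *s (?A *v u) = u"
    using assms(3) by (simp add: vec.scale)
  then have Au: "?A *v u = inverse \<mu> *s u"
    using assms(2) by (metis vec.scale_scale left_inverse vec.scale_one)
  have "?B *v Re_vec v = Re_vec (?A *v v)" for v
    by (simp add: Re_vec_def vec_eq_iff matrix_vector_mult_def)
  moreover have "inverse \<mu> * (w / \<mu> ^ n) = w / \<mu> ^ Suc n"
    by (simp add: field_simps)
  ultimately show ?case
    using Suc by (simp add: vec.scale Au mult.commute)
qed simp

section \<open>Lattice points and lattice coverings\<close>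

lemma real_vec_add: "real_vec (j + k) = real_vec j + real_vec k"
  by (simp add: real_vec_def vec_eq_iff)

lemma real_vec_diff: "real_vec (j - k) = real_vec j - real_vec k"
  by (simp add: real_vec_def vec_eq_iff)

lemma real_vec_0 [simp]: "real_vec 0 = 0"
  by (simp add: real_vec_def vec_eq_iff)

lemma real_vec_eq_iff: "real_vec j = real_vec k \<longleftrightarrow> j = k"
  by (simp add: real_vec_def vec_eq_iff)

lemma real_vec_mult: "real_vec (M *v k) = real_mat M *v real_vec k"
  by (simp add: real_vec_def real_mat_def vec_eq_iff matrix_vector_mult_def)

lemma finite_vec_components:
  assumes "finite I"
  shows "finite {k :: 'a ^ 's. \<forall>i. k $ i \<in> I}"
proof -
  have "{k :: 'a ^ 's. \<forall>i. k $ i \<in> I} \<subseteq> vec_lambda ` (PiE UNIV (\<lambda>_. I))"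
  proof
    fix k :: "'a ^ 's" assume "k \<in> {k. \<forall>i. k $ i \<in> I}"
    then have "vec_nth k \<in> PiE UNIV (\<lambda>_. I)" by auto
    then show "k \<in> vec_lambda ` (PiE UNIV (\<lambda>_. I))"
      by (metis imageI vec_nth_inverse)
  qed
  moreover have "finite (PiE (UNIV :: 's set) (\<lambda>_. I))"
    using assms by (intro finite_PiE) auto
  ultimately show ?thesis
    using finite_subset by blast
qed

lemma finite_lattice_points:
  assumes "bounded X"
  shows "finite {k. real_vec k \<in> X}"
proof -
  obtain r where r: "\<And>x. x \<in> X \<Longrightarrow> norm x \<le> r"
    using assms by (auto simp: bounded_iff)
  have "k $ i \<in> {-\<lceil>r\<rceil>..\<lceil>r\<rceil>}" if "real_vec k \<in> X" for k :: "int ^ 'a" and i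
  proof -
    have "\<bar>real_vec k $ i\<bar> \<le> r"
      using component_le_norm_cart[of "real_vec k" i] r[OF that] by linarith
    then show ?thesis
      by (simp add: real_vec_def) linarith
  qed
  then have "{k. real_vec k \<in> X} \<subseteq> {k. \<forall>i. k $ i \<in> {-\<lceil>r\<rceil>..\<lceil>r\<rceil>}}"
    by blast
  then show ?thesis
    using finite_vec_components finite_subset by blast
qed

lemma lattice_point_near:
  fixes x :: "real ^ 's"
  shows "\<exists>k. norm (x - real_vec k) \<le> real CARD('s)"
proof -
  define k :: "int ^ 's" where "k = (\<chi> i. \<lfloor>x $ i\<rfloor>)"
  have "norm (x - real_vec k) \<le> (\<Sum>i\<in>UNIV. \<bar>(x - real_vec k) $ i\<bar>)"
    by (rule norm_le_l1_cart)
  also have "\<dots> \<le> (\<Sum>i\<in>(UNIV :: 's set). 1)"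
    by (intro sum_mono) (simp add: real_vec_def k_def, linarith)
  finally show ?thesis by auto
qed

text \<open>Moving the centre to a nearby lattice point turns every ball into a subset of one fixed larger ball
around 0.\<close>

lemma lattice_points_in_ball_bounded:
  "\<exists>N. \<forall>z :: real ^ 's. card {k. norm (real_vec k - z) \<le> r} \<le> N"
proof -
  define P :: "(int ^ 's) set" where "P = {k. real_vec k \<in> cball 0 (r + real CARD('s))}"
  have P: "finite P"
    unfolding P_def by (rule finite_lattice_points) simp
  have "card {k. norm (real_vec k - z) \<le> r} \<le> card P" for z :: "real ^ 's"
  proof -
    obtain j where j: "norm (z - real_vec j) \<le> real CARD('s)"
      using lattice_point_near by blast
    have "{k. norm (real_vec k - z) \<le> r} \<subseteq> (\<lambda>k. k + j) ` P"
    proof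
      fix k assume "k \<in> {k. norm (real_vec k - z) \<le> r}"
      moreover have "real_vec (k - j) = (real_vec k - z) + (z - real_vec j)"
        by (simp add: real_vec_diff)
      ultimately have "norm (real_vec (k - j)) \<le> r + real CARD('s)"
        using j norm_triangle_ineq[of "real_vec k - z" "z - real_vec j"] by auto
      then have "k - j \<in> P" by (simp add: P_def)
      then show "k \<in> (\<lambda>k. k + j) ` P" by force
    qed
    then show ?thesis
      by (rule surj_card_le[OF P])
  qed
  then show ?thesis by blast
qed

text \<open>A set whose translates cover has at least the measure of a fundamental domain: the unit cube C is
covered by the sets C \<inter> (k + H), and translating them back by k gives disjoint subsets of H. The open
cube suffices, since it has the full measure 1.\<close>

lemma lattice_cover_measure_ge_1:
  fixes H :: "(real ^ 's) set"
  assumes H: "H \<in> lmeasurable" "bounded H"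
    and cover: "\<And>x. \<exists>k. \<exists>h\<in>H. x = real_vec k + h"
  shows "1 \<le> measure lebesgue H"
proof -
  define C :: "(real ^ 's) set" where "C = box 0 One"
  have C: "C \<in> lmeasurable" "measure lebesgue C = 1"
    by (simp_all add: C_def lmeasurable_box content_unit)
  have bC: "bounded C" by (simp add: C_def bounded_box)
  define F where "F = {k :: int ^ 's. real_vec k \<in> (\<Union>x\<in>C. \<Union>y\<in>H. {x - y})}"
  have finF: "finite F"
    unfolding F_def by (intro finite_lattice_points bounded_differences bC H)
  \<comment> \<open>F lists the finitely many translates of H that meet the cube\<close>
  have subC: "C \<subseteq> (\<Union>k\<in>F. C \<inter> (+) (real_vec k) ` H)"
  proof
    fix x assume x: "x \<in> C"
    obtain k h where kh: "h \<in> H" "x = real_vec k + h" using cover by blast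
    then have "k \<in> F" using x unfolding F_def by (force intro!: exI[of _ x] exI[of _ h])
    then show "x \<in> (\<Union>k\<in>F. C \<inter> (+) (real_vec k) ` H)" using x kh by blast
  qed
  define T where "T k = (+) (- real_vec k) ` C \<inter> H" for k :: "int ^ 's"
  have Tm: "T k \<in> lmeasurable" for k
    unfolding T_def by (intro fmeasurable.Int measurable_translation C H)
  have trans: "C \<inter> (+) (real_vec k) ` H = (+) (real_vec k) ` T k" for k
    unfolding T_def by (force simp: image_iff)
  have "1 = measure lebesgue C" using C by simp
  also have "\<dots> \<le> measure lebesgue (\<Union>k\<in>F. C \<inter> (+) (real_vec k) ` H)"
    using C H finF
    by (intro measure_mono_fmeasurable subC fmeasurable.finite_UN fmeasurable.Int measurable_translation)
       (auto simp: fmeasurableD)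
  also have "\<dots> \<le> (\<Sum>k\<in>F. measure lebesgue (C \<inter> (+) (real_vec k) ` H))"
    using C H by (intro measure_UNION_le finF fmeasurableD fmeasurable.Int measurable_translation)
  also have "\<dots> = (\<Sum>k\<in>F. measure lebesgue (T k))"
    by (simp add: trans measure_translation)
  also have "\<dots> = measure lebesgue (\<Union>k\<in>F. T k)"
  proof (rule measure_finite_Union[symmetric, OF finF])
    show "T ` F \<subseteq> sets lebesgue" using Tm by (auto simp: fmeasurableD)
    show "emeasure lebesgue (T k) \<noteq> \<infinity>" for k
      using fmeasurableD2[OF Tm] by simp
    show "disjoint_family_on T F"
    proof (clarsimp simp: disjoint_family_on_def disjoint_iff)
      fix j k x assume "j \<noteq> k" and x: "x \<in> T j" "x \<in> T k"
      then obtain i where i: "j $ i \<noteq> k $ i" by (auto simp: vec_eq_iff)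
      have "x + real_vec l \<in> C" if "x \<in> T l" for l
        using that by (auto simp: T_def add.commute)
      moreover have "0 < y $ i \<and> y $ i < 1" if "y \<in> C" for y
        using that by (auto simp: C_def mem_box inner_axis axis_in_Basis_iff dest: bspec[of _ _ "axis i 1"])
      ultimately have "0 < (x + real_vec l) $ i \<and> (x + real_vec l) $ i < 1" if "x \<in> T l" for l
        using that by blast
      from this[OF x(1)] this[OF x(2)] i show False
        by (simp add: real_vec_def)
    qed
  qed
  also have "\<dots> \<le> measure lebesgue H"
  proof (rule measure_mono_fmeasurable)
    show "(\<Union>k\<in>F. T k) \<subseteq> H" by (auto simp: T_def)
    show "(\<Union>k\<in>F. T k) \<in> sets lebesgue"
      using finF Tm by (intro sets.finite_UN fmeasurableD)
  qed (rule H)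
  finally show ?thesis .
qed

section \<open>Attractors of finite digit sets\<close>

lemma real_mat_mult_inverse:
  assumes "det (M :: int ^ 's ^ 's) \<noteq> 0"
  shows "real_mat M *v (matrix_inv (real_mat M) *v x) = x"
        "matrix_inv (real_mat M) *v (real_mat M *v x) = x"
  by (simp_all add: matrix_vector_mul_assoc real_mat_inverse[OF assms])

text \<open>This is M adj(M) = det M, with the entries of adj(M) x given by Cramer's rule as integer
determinants.\<close>

lemma det_multiple_in_lattice:
  fixes M :: "int ^ 's ^ 's"
  assumes "det M \<noteq> 0"
  shows "\<exists>y. det M *s x = M *v y"
proof -
  \<comment> \<open>adj(M) x, written with determinants of integer matrices\<close>
  define y :: "int ^ 's" where "y = (\<chi> k. det (\<chi> i j. if j = k then x $ i else M $ i $ j))"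
  have det_of_int: "det (\<chi> i j. real_of_int (N i j)) = of_int (det (\<chi> i j. N i j))" for N :: "'s \<Rightarrow> 's \<Rightarrow> int"
    by (simp add: det_def)
  have det: "det (real_mat M) = real_of_int (det M)"
    by (simp add: real_mat_def det_def)
  have "real_vec y = (\<chi> k. det (\<chi> i j. if j = k then real_vec x $ i else real_mat M $ i $ j))"
    by (simp add: vec_eq_iff real_vec_def y_def real_mat_def det_of_int[symmetric] if_distrib cong: if_cong)
  also have "\<dots> = det (real_mat M) *s (\<chi> k. det (\<chi> i j. if j = k then real_vec x $ i else real_mat M $ i $ j) / det (real_mat M))"
    using assms det by (simp add: vec_eq_iff)
  also have "real_mat M *v \<dots> = det (real_mat M) *s real_vec x"
    using cramer[of "real_mat M"] assms det by (simp add: vec.scale)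
  finally have "real_vec (M *v y) = real_vec (det M *s x)"
    by (simp add: real_vec_mult) (simp add: det real_vec_def vec_eq_iff)
  then show ?thesis by (metis real_vec_eq_iff)
qed

text \<open>Digits that agree modulo det M represent the same coset, so there are at most |det M|^s of them.\<close>

lemma finite_complete_digits:
  fixes M :: "int ^ 's ^ 's"
  assumes "det M \<noteq> 0" "complete_digits M D"
  shows "finite D"
proof -
  define N where "N = \<bar>det M\<bar>"
  have N: "N > 0" using assms by (simp add: N_def)
  define f :: "int ^ 's \<Rightarrow> int ^ 's" where "f d = (\<chi> i. d $ i mod N)" for d
  have "inj_on f D"
  proof
    fix d e assume de: "d \<in> D" "e \<in> D" "f d = f e"
    have "\<exists>q. d $ i - e $ i = det M * q" for i
    proof -
      have "d $ i mod N = e $ i mod N"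
        using de(3) by (simp add: f_def vec_eq_iff)
      then have "det M dvd d $ i - e $ i"
        by (simp add: N_def mod_eq_dvd_iff)
      then show ?thesis by (auto simp: dvd_def)
    qed
    then obtain q where "\<And>i. d $ i - e $ i = det M * q i" by metis
    then have "d - e = det M *s (\<chi> i. q i)"
      by (simp add: vec_eq_iff)
    then obtain y where "d - e = M *v y"
      using det_multiple_in_lattice[OF assms(1)] by metis
    moreover have "d - d = M *v 0" by simp
    ultimately show "d = e"
      using assms(2) de unfolding complete_digits_def by metis
  qed
  moreover have "f ` D \<subseteq> {k. \<forall>i. k $ i \<in> {0..<N}}"
    using N by (auto simp: f_def)
  then have "finite (f ` D)"
    by (rule finite_subset) (rule finite_vec_components, simp)
  ultimately show ?thesis
    using finite_imageD by blast
qed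

locale expansive_matrix =
  fixes M :: "int ^ 's ^ 's"
  assumes expansive: "expansive M" and det_nonzero: "det M \<noteq> 0"
begin

definition contract :: "real ^ 's \<Rightarrow> real ^ 's" where
  "contract = (*v) (matrix_inv (real_mat M))"

lemma linear_contract: "linear contract"
  unfolding contract_def by (rule matrix_vector_mul_linear)

lemma linear_contract_pow: "linear (contract ^^ n)"
proof (induction n)
  case 0
  show ?case using linear_id by (simp add: id_def)
next
  case (Suc n)
  show ?case
    unfolding funpow.simps by (rule linear_compose[OF Suc linear_contract])
qed

lemma contract_mult [simp]: "contract (real_mat M *v x) = x"
  using real_mat_mult_inverse[OF det_nonzero] by (simp add: contract_def)

lemma mult_contract [simp]: "real_mat M *v contract x = x"
  using real_mat_mult_inverse[OF det_nonzero] by (simp add: contract_def)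

lemma contract_pow_Suc: "(contract ^^ Suc n) x = (contract ^^ n) (contract x)"
  by (simp add: funpow_swap1)

lemma contract_add: "contract (x + y) = contract x + contract y"
  by (rule linear_add[OF linear_contract])

lemma contract_pow_add: "(contract ^^ n) (x + y) = (contract ^^ n) x + (contract ^^ n) y"
  by (rule linear_add[OF linear_contract_pow])

lemma contract_pow_diff: "(contract ^^ n) (x - y) = (contract ^^ n) x - (contract ^^ n) y"
  by (rule linear_diff[OF linear_contract_pow])

lemma contract_pow_mult_pow: "(contract ^^ n) ((((*v) (real_mat M)) ^^ n) x) = x"
  by (induction n) (simp_all add: contract_pow_Suc del: funpow.simps(2), simp)

lemma mult_pow_contract_pow: "(((*v) (real_mat M)) ^^ n) ((contract ^^ n) x) = x"
  by (induction n arbitrary: x) (simp_all add: funpow_swap1 del: funpow.simps(2), simp add: funpow_swap1)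

lemma summable_contract: "summable (\<lambda>n. norm ((contract ^^ n) x))"
  unfolding contract_def by (rule summable_inverse_orbit[OF expansive det_nonzero])

text \<open>Convergence on the finitely many basis vectors is uniform on bounded sets.\<close>

lemma contract_pow_uniform:
  assumes "e > 0"
  shows "\<forall>\<^sub>F n in sequentially. \<forall>x. norm x \<le> r \<longrightarrow> norm ((contract ^^ n) x) < e"
proof -
  define \<beta> where "\<beta> n = (\<Sum>b\<in>Basis. norm ((contract ^^ n) b))" for n
  have "\<beta> \<longlonglongrightarrow> (\<Sum>b\<in>(Basis :: (real ^ 's) set). 0)"
    unfolding \<beta>_def by (intro tendsto_sum summable_LIMSEQ_zero summable_contract)
  then have "(\<lambda>n. \<bar>r\<bar> * \<beta> n) \<longlonglongrightarrow> 0"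
    by (auto intro: tendsto_mult_right_zero)
  then have "\<forall>\<^sub>F n in sequentially. \<bar>r\<bar> * \<beta> n < e"
    using assms by (rule order_tendstoD)
  moreover have "norm ((contract ^^ n) x) \<le> \<bar>r\<bar> * \<beta> n" if x: "norm x \<le> r" for x n
  proof -
    have "(contract ^^ n) x = (contract ^^ n) (\<Sum>b\<in>Basis. (x \<bullet> b) *\<^sub>R b)"
      by (simp add: euclidean_representation)
    also have "\<dots> = (\<Sum>b\<in>Basis. (x \<bullet> b) *\<^sub>R (contract ^^ n) b)"
      by (simp add: linear_sum[OF linear_contract_pow] linear_scale[OF linear_contract_pow])
    finally have "norm ((contract ^^ n) x) \<le> (\<Sum>b\<in>Basis. norm ((x \<bullet> b) *\<^sub>R (contract ^^ n) b))"
      by (simp only: norm_sum)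
    also have "\<dots> \<le> (\<Sum>b\<in>Basis. \<bar>r\<bar> * norm ((contract ^^ n) b))"
    proof (rule sum_mono)
      fix b :: "real ^ 's" assume "b \<in> Basis"
      then have "\<bar>x \<bullet> b\<bar> \<le> \<bar>r\<bar>"
        using Basis_le_norm[of b x] x by linarith
      then show "norm ((x \<bullet> b) *\<^sub>R (contract ^^ n) b) \<le> \<bar>r\<bar> * norm ((contract ^^ n) b)"
        by (simp add: mult_right_mono)
    qed
    also have "\<dots> = \<bar>r\<bar> * \<beta> n"
      by (simp add: \<beta>_def sum_distrib_left)
    finally show ?thesis .
  qed
  ultimately show ?thesis
    by (elim eventually_mono) (metis le_less_trans)
qed

lemma contract_pow_bounded_tendsto_0:
  assumes "bounded (range x)"
  shows "(\<lambda>n. (contract ^^ n) (x n)) \<longlonglongrightarrow> 0"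
proof -
  obtain r where r: "\<And>n. norm (x n) \<le> r"
    using assms by (auto simp: bounded_iff)
  show ?thesis
  proof (rule tendstoI)
    fix e :: real assume "e > 0"
    show "\<forall>\<^sub>F n in sequentially. dist ((contract ^^ n) (x n)) 0 < e"
      using contract_pow_uniform[OF \<open>e > 0\<close>, of r] by eventually_elim (use r in simp)
  qed
qed

lemma digit_attractorI:
  assumes "\<And>i. \<gamma> i \<in> S" "(\<lambda>i. (contract ^^ Suc i) (real_vec (\<gamma> i))) sums x"
  shows "x \<in> digit_attractor M S"
  using assms unfolding digit_attractor_def contract_def by blast

lemma digit_attractorE:
  assumes "x \<in> digit_attractor M S"
  obtains \<gamma> where "\<And>i. \<gamma> i \<in> S" "(\<lambda>i. (contract ^^ Suc i) (real_vec (\<gamma> i))) sums x"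
  using assms unfolding digit_attractor_def contract_def by blast

lemma digit_series_norm_bound:
  assumes "finite S" "\<And>i. \<gamma> i \<in> S"
  shows "summable (\<lambda>i. norm ((contract ^^ Suc i) (real_vec (\<gamma> i))))"
    and "(\<Sum>i. norm ((contract ^^ Suc i) (real_vec (\<gamma> i))))
           \<le> (\<Sum>i. \<Sum>d\<in>S. norm ((contract ^^ Suc i) (real_vec d)))"
proof -
  let ?b = "\<lambda>i. \<Sum>d\<in>S. norm ((contract ^^ Suc i) (real_vec d))"
  have le: "norm ((contract ^^ Suc i) (real_vec (\<gamma> i))) \<le> ?b i" for i
    using assms by (intro member_le_sum[of "\<gamma> i" S "\<lambda>d. norm ((contract ^^ Suc i) (real_vec d))"]) auto
  have b: "summable ?b"
    by (intro summable_sum) (subst summable_Suc_iff, rule summable_contract)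
  show s: "summable (\<lambda>i. norm ((contract ^^ Suc i) (real_vec (\<gamma> i))))"
    by (rule summable_comparison_test'[OF b, of 0]) (use le in simp)
  show "(\<Sum>i. norm ((contract ^^ Suc i) (real_vec (\<gamma> i)))) \<le> suminf ?b"
    by (intro suminf_le le s b)
qed

lemma bounded_digit_attractor:
  assumes "finite S"
  shows "bounded (digit_attractor M S)"
proof (rule boundedI)
  fix x assume "x \<in> digit_attractor M S"
  then obtain \<gamma> where \<gamma>: "\<And>i. \<gamma> i \<in> S" "(\<lambda>i. (contract ^^ Suc i) (real_vec (\<gamma> i))) sums x"
    by (rule digit_attractorE) (rule that)
  have "norm x \<le> (\<Sum>i. norm ((contract ^^ Suc i) (real_vec (\<gamma> i))))"
    unfolding sums_unique[OF \<gamma>(2)]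
    by (rule summable_norm[OF digit_series_norm_bound(1)[OF assms \<gamma>(1)]])
  then show "norm x \<le> (\<Sum>i. \<Sum>d\<in>S. norm ((contract ^^ Suc i) (real_vec d)))"
    using digit_series_norm_bound(2)[of S \<gamma>, OF assms \<gamma>(1)] by linarith
qed

text \<open>Iterating x = M^(-1)(d + y) expands x into a digit series whose remainder M^(-n) y_n tends to 0 because
X is bounded. With X the closure of an attractor this gives closedness, and with X the set where a
refinable function is nonzero it locates the support.\<close>

lemma subset_digit_attractor:
  assumes X: "bounded X" and step: "\<And>x. x \<in> X \<Longrightarrow> \<exists>d\<in>S. \<exists>y\<in>X. x = contract (real_vec d + y)"
  shows "X \<subseteq> digit_attractor M S"
proof
  fix x assume x: "x \<in> X"
  obtain d t where dt: "\<And>x. x \<in> X \<Longrightarrow> d x \<in> S" "\<And>x. x \<in> X \<Longrightarrow> t x \<in> X"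
      "\<And>x. x \<in> X \<Longrightarrow> x = contract (real_vec (d x) + t x)"
    using step by metis
  define z where "z n = (t ^^ n) x" for n
  have z: "z n \<in> X" for n
    by (induction n) (auto simp: z_def x dt(2))
  have split: "x = (\<Sum>i<n. (contract ^^ Suc i) (real_vec (d (z i)))) + (contract ^^ n) (z n)" for n
  proof (induction n)
    case 0
    then show ?case by (simp add: z_def)
  next
    case (Suc n)
    have "z n = contract (real_vec (d (z n)) + z (Suc n))"
      using dt(3)[OF z[of n]] by (simp add: z_def)
    then have "(contract ^^ n) (z n)
        = (contract ^^ Suc n) (real_vec (d (z n))) + (contract ^^ Suc n) (z (Suc n))"
      by (metis contract_pow_Suc contract_pow_add)
    with Suc show ?case by (simp add: add.assoc)
  qed
  have "bounded (range z)"
    by (rule bounded_subset[OF X]) (use z in blast)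
  then have "(\<lambda>n. x - (contract ^^ n) (z n)) \<longlonglongrightarrow> x - 0"
    by (intro tendsto_diff tendsto_const contract_pow_bounded_tendsto_0)
  moreover have "x - (contract ^^ n) (z n) = (\<Sum>i<n. (contract ^^ Suc i) (real_vec (d (z i))))" for n
    unfolding diff_eq_eq by (rule split)
  ultimately have "(\<lambda>i. (contract ^^ Suc i) (real_vec (d (z i)))) sums x"
    by (simp add: sums_def)
  then show "x \<in> digit_attractor M S"
    by (rule digit_attractorI[rotated]) (use dt(1) z in blast)
qed

lemma contract_digit_series:
  assumes "(\<lambda>i. (contract ^^ Suc i) (real_vec (\<gamma> (Suc i)))) sums y"
  shows "(\<lambda>i. (contract ^^ Suc i) (real_vec (\<gamma> i))) sums contract (real_vec (\<gamma> 0) + y)"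
proof -
  have "bounded_linear contract"
    using linear_contract by (simp add: linear_conv_bounded_linear)
  from bounded_linear.sums[OF this assms]
  have "(\<lambda>i. (contract ^^ Suc (Suc i)) (real_vec (\<gamma> (Suc i)))) sums contract y"
    by simp
  then have "(\<lambda>i. (contract ^^ Suc i) (real_vec (\<gamma> i)))
      sums (contract y + (contract ^^ Suc 0) (real_vec (\<gamma> 0)))"
    by (rule sums_Suc)
  then show ?thesis
    by (simp add: contract_add add.commute)
qed

lemma digit_attractor_decompose:
  assumes "finite S" "x \<in> digit_attractor M S"
  obtains d y where "d \<in> S" "y \<in> digit_attractor M S" "x = contract (real_vec d + y)"
proof -
  obtain \<gamma> where \<gamma>: "\<And>i. \<gamma> i \<in> S" "(\<lambda>i. (contract ^^ Suc i) (real_vec (\<gamma> i))) sums x"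
    using assms(2) by (rule digit_attractorE) (rule that)
  define y where "y = (\<Sum>i. (contract ^^ Suc i) (real_vec (\<gamma> (Suc i))))"
  have y: "(\<lambda>i. (contract ^^ Suc i) (real_vec (\<gamma> (Suc i)))) sums y"
    unfolding y_def
    by (rule summable_sums[OF summable_norm_cancel[OF digit_series_norm_bound(1)[OF assms(1)]]]) (rule \<gamma>(1))
  from y have "x = contract (real_vec (\<gamma> 0) + y)"
    using sums_unique2[OF \<gamma>(2) contract_digit_series] by blast
  moreover have "y \<in> digit_attractor M S"
    by (rule digit_attractorI[OF \<gamma>(1) y])
  ultimately show ?thesis using that \<gamma>(1) by blast
qed

lemma digit_attractor_compose:
  assumes "d \<in> S" "y \<in> digit_attractor M S"
  shows "contract (real_vec d + y) \<in> digit_attractor M S"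
proof -
  obtain \<gamma> where \<gamma>: "\<And>i. \<gamma> i \<in> S" "(\<lambda>i. (contract ^^ Suc i) (real_vec (\<gamma> i))) sums y"
    using assms(2) by (rule digit_attractorE) (rule that)
  define \<delta> where "\<delta> = case_nat d \<gamma>"
  have "(\<lambda>i. (contract ^^ Suc i) (real_vec (\<delta> (Suc i)))) sums y"
    using \<gamma>(2) by (simp add: \<delta>_def)
  then have "(\<lambda>i. (contract ^^ Suc i) (real_vec (\<delta> i))) sums contract (real_vec d + y)"
    using contract_digit_series[of \<delta> y] by (simp add: \<delta>_def)
  moreover have "\<delta> i \<in> S" for i
    using assms(1) \<gamma>(1) by (cases i) (auto simp: \<delta>_def)
  ultimately show ?thesis
    by (rule digit_attractorI[rotated])
qed

text \<open>The closure is contained in its own image under the finitely many maps of the iterated function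
system, so its points have digit expansions too.\<close>

lemma closed_digit_attractor:
  assumes "finite S"
  shows "closed (digit_attractor M S)"
proof -
  let ?G = "digit_attractor M S"
  let ?H = "\<Union>d\<in>S. (\<lambda>g. contract (real_vec d + g)) ` closure ?G"
  have bdd: "bounded (closure ?G)"
    using bounded_digit_attractor[OF assms] by (rule bounded_closure)
  have "continuous_on UNIV contract"
    using linear_contract by (simp add: linear_continuous_on linear_conv_bounded_linear)
  then have cont: "continuous_on (closure ?G) (\<lambda>g. contract (real_vec d + g))" for d
    by (rule continuous_on_compose2) (auto intro: continuous_intros)
  have "compact (closure ?G)"
    using bdd by (simp add: compact_eq_bounded_closed)
  then have "closed ((\<lambda>g. contract (real_vec d + g)) ` closure ?G)" for d
    by (rule compact_imp_closed[OF compact_continuous_image[OF cont]])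
  then have "closed ?H"
    using assms by (intro closed_UN) auto
  moreover have "?G \<subseteq> ?H"
  proof
    fix x assume "x \<in> ?G"
    then obtain d y where "d \<in> S" "y \<in> ?G" "x = contract (real_vec d + y)"
      using digit_attractor_decompose[OF assms] by blast
    then show "x \<in> ?H" using closure_subset by blast
  qed
  ultimately have "closure ?G \<subseteq> ?H"
    by (rule closure_minimal[rotated])
  then have "closure ?G \<subseteq> ?G"
    by (intro subset_digit_attractor bdd) blast
  then show ?thesis
    using closure_subset_eq by blast
qed

end

section \<open>The tiling by lattice translates of the tile\<close>

text \<open>The image of the segment is connected, hence contains the interval between f x and f y, and it is
covered by card F intervals of length 2 \<delta>. Comparing lengths avoids ordering the sets X k into a
chain.\<close>

lemma chain_oscillation_bound:
  fixes f :: "'a::euclidean_space \<Rightarrow> real"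
  assumes f: "continuous_on (closed_segment x y) f"
    and F: "finite F" "closed_segment x y \<subseteq> (\<Union>k\<in>F. X k)" and "\<delta> \<ge> 0"
    and osc: "\<And>k p q. k \<in> F \<Longrightarrow> p \<in> X k \<Longrightarrow> q \<in> X k \<Longrightarrow> p \<in> closed_segment x y \<Longrightarrow>
                q \<in> closed_segment x y \<Longrightarrow> \<bar>f p - f q\<bar> \<le> \<delta>"
  shows "\<bar>f x - f y\<bar> \<le> real (card F) * (2 * \<delta>)"
proof -
  let ?S = "closed_segment x y"
  define a where "a = min (f x) (f y)"
  define b where "b = max (f x) (f y)"
  define m where "m k = f (SOME p. p \<in> X k \<inter> ?S)" for k
  have "connected (f ` ?S)"
    by (intro connected_continuous_image f) simp
  then have "{a..b} \<subseteq> f ` ?S"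
    by (rule connected_contains_Icc) (auto simp: a_def b_def min_def max_def)
  also have "\<dots> \<subseteq> (\<Union>k\<in>F. {m k - \<delta>..m k + \<delta>})"
  proof
    fix t assume "t \<in> f ` ?S"
    then obtain p where p: "p \<in> ?S" "t = f p" by blast
    then obtain k where k: "k \<in> F" "p \<in> X k" using F by blast
    have "(SOME p. p \<in> X k \<inter> ?S) \<in> X k \<inter> ?S"
      by (rule someI[of _ p]) (use p k in blast)
    then have "\<bar>f p - m k\<bar> \<le> \<delta>"
      unfolding m_def using osc[OF k(1,2)] p(1) by blast
    then have "t \<in> {m k - \<delta>..m k + \<delta>}"
      using p by auto
    then show "t \<in> (\<Union>k\<in>F. {m k - \<delta>..m k + \<delta>})" using k by blast
  qed
  finally have "{a..b} \<subseteq> (\<Union>k\<in>F. {m k - \<delta>..m k + \<delta>})" .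
  moreover have "{l..u} \<in> fmeasurable lborel" for l u :: real
    by (simp add: fmeasurable_def emeasure_lborel_Icc_eq)
  ultimately have "measure lborel {a..b} \<le> measure lborel (\<Union>k\<in>F. {m k - \<delta>..m k + \<delta>})"
    using F by (intro measure_mono_fmeasurable fmeasurable.finite_UN) auto
  also have "\<dots> \<le> (\<Sum>k\<in>F. measure lborel {m k - \<delta>..m k + \<delta>})"
    using F by (intro measure_UNION_le) auto
  also have "\<dots> = real (card F) * (2 * \<delta>)"
    using \<open>\<delta> \<ge> 0\<close> by simp
  finally show ?thesis
    by (simp add: a_def b_def min_def max_def split: if_splits)
qed

locale digit_tile = expansive_matrix M for M :: "int ^ 's ^ 's" +
  fixes D :: "(int ^ 's) set"
  assumes digits: "complete_digits M D" and zero_digit: "0 \<in> D"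
    and emeasure_tile: "emeasure lebesgue (digit_attractor M D) = 1"
begin

abbreviation G :: "(real ^ 's) set" where
  "G \<equiv> digit_attractor M D"

lemma finite_D: "finite D"
  by (rule finite_complete_digits[OF det_nonzero digits])

lemma bounded_G: "bounded G"
  by (rule bounded_digit_attractor[OF finite_D])

lemma closed_G: "closed G"
  by (rule closed_digit_attractor[OF finite_D])

lemma lmeasurable_G: "G \<in> lmeasurable"
  using bounded_G closed_G by (intro lmeasurable_compact) (simp add: compact_eq_bounded_closed)

lemma measure_G: "measure lebesgue G = 1"
  by (simp add: measure_def emeasure_tile)

lemma zero_in_G: "0 \<in> G"
proof -
  have "(contract ^^ n) 0 = 0" for n
    by (rule linear_0[OF linear_contract_pow])
  then have "(\<lambda>i. (contract ^^ Suc i) (real_vec 0)) sums 0"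
    by (simp only: real_vec_0 sums_zero)
  then show ?thesis
    by (rule digit_attractorI[rotated]) (rule zero_digit)
qed

text \<open>Division of a lattice point by M with remainder in D: one application of the inverse moves the tile
at j into the tile at the quotient y, with d as the first digit.\<close>

lemma lattice_division:
  obtains d y where "d \<in> D"
    "\<And>g. contract (real_vec j + g) = real_vec y + contract (real_vec d + g)"
proof -
  obtain d y where dy: "d \<in> D" "j - d = M *v y"
    using digits unfolding complete_digits_def by metis
  then have "real_vec j = real_mat M *v real_vec y + real_vec d"
    by (metis diff_add_cancel real_vec_add real_vec_mult)
  then have "contract (real_vec j + g) = real_vec y + contract (real_vec d + g)" for g
    by (simp add: contract_add add.assoc)
  with dy that show ?thesis by blast
qed

text \<open>The union T of the translates is mapped into itself by M^(-1) and contains the lattice, so it contains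
every M^(-n) k and is dense. It is also closed, because near a given point only finitely many
translates matter.\<close>

lemma lattice_translates_cover: "\<exists>k. \<exists>g\<in>G. x = real_vec k + g"
proof -
  define T where "T = {real_vec k + g | k g. g \<in> G}"
  have contract_T: "contract t \<in> T" if t: "t \<in> T" for t
  proof -
    obtain k g where kg: "t = real_vec k + g" "g \<in> G" using t by (auto simp: T_def)
    obtain d y where dy: "d \<in> D" "contract (real_vec k + g) = real_vec y + contract (real_vec d + g)"
      using lattice_division by metis
    then have "contract (real_vec d + g) \<in> G" using kg by (intro digit_attractor_compose)
    then show ?thesis using dy kg unfolding T_def by blast
  qed
  have pow_T: "(contract ^^ n) t \<in> T" if "t \<in> T" for n t
    using that by (induction n) (auto simp: contract_T)
  have int_T: "real_vec k \<in> T" for k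
    unfolding T_def using zero_in_G by force
  have dense: "x \<in> closure T"
  proof (rule closure_approachable[THEN iffD2], intro allI impI)
    fix e :: real assume "e > 0"
    then obtain n where n: "\<And>z. norm z \<le> real CARD('s) \<Longrightarrow> norm ((contract ^^ n) z) < e"
      using contract_pow_uniform[of e "real CARD('s)"] by (auto simp: eventually_sequentially)
    define z where "z = (((*v) (real_mat M)) ^^ n) x"
    obtain k where k: "norm (z - real_vec k) \<le> real CARD('s)"
      using lattice_point_near by blast
    have "x - (contract ^^ n) (real_vec k) = (contract ^^ n) (z - real_vec k)"
      by (simp add: contract_pow_diff z_def contract_pow_mult_pow)
    then have "dist ((contract ^^ n) (real_vec k)) x < e"
      using n[OF k] by (metis dist_commute dist_norm)
    then show "\<exists>y\<in>T. dist y x < e"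
      using pow_T int_T by blast
  qed
  obtain R where R: "\<And>g. g \<in> G \<Longrightarrow> norm g \<le> R"
    using bounded_G by (auto simp: bounded_iff)
  define F :: "(int ^ 's) set" where "F = {k. real_vec k \<in> cball 0 (norm x + 1 + R)}"
  have F: "finite F"
    unfolding F_def by (rule finite_lattice_points) simp
  \<comment> \<open>the translates that can come within distance 1 of x\<close>
  define T' where "T' = (\<Union>k\<in>F. (+) (real_vec k) ` G)"
  have "closed T'"
    unfolding T'_def by (intro closed_UN F ballI closed_translation closed_G)
  moreover have "x \<in> closure T'"
  proof (rule closure_approachable[THEN iffD2], intro allI impI)
    fix e :: real assume "e > 0"
    then have "min e 1 > 0" by simp
    then obtain t where t: "t \<in> T" "dist t x < min e 1"
      using dense closure_approachable by blast
    then obtain k g where kg: "t = real_vec k + g" "g \<in> G" by (auto simp: T_def)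
    have "norm t \<le> norm x + 1"
      using t norm_triangle_sub[of t x] by (simp add: dist_norm)
    moreover have "norm (real_vec k) \<le> norm t + norm g"
      using norm_triangle_ineq4[of t g] kg by simp
    ultimately have "k \<in> F"
      using R[OF kg(2)] by (simp add: F_def)
    then have "t \<in> T'" using kg by (auto simp: T'_def)
    then show "\<exists>y\<in>T'. dist y x < e" using t by auto
  qed
  ultimately have "x \<in> T'" by simp
  then show ?thesis by (auto simp: T'_def)
qed

text \<open>Remove the overlap Q from G. The translates of what is left still cover: a point g of G can be moved by
-l as long as it stays in G, which happens only finitely often, and the last point reached is not in
l + G. Hence the measure of G - Q is still at least 1, while that of G is 1.\<close>

lemma negligible_tile_overlap:
  assumes "l \<noteq> 0"
  shows "negligible (G \<inter> (+) (real_vec l) ` G)"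
proof -
  let ?Q = "G \<inter> (+) (real_vec l) ` G"
  have Q: "?Q \<in> lmeasurable"
    by (intro fmeasurable.Int lmeasurable_G measurable_translation)
  have "1 \<le> measure lebesgue (G - ?Q)"
  proof (rule lattice_cover_measure_ge_1)
    show "G - ?Q \<in> lmeasurable"
      by (intro fmeasurable.Diff lmeasurable_G Q)
    show "bounded (G - ?Q)"
      using bounded_G by (rule bounded_subset) blast
    fix x
    obtain k g where kg: "x = real_vec k + g" "g \<in> G"
      using lattice_translates_cover by blast
    obtain R where R: "\<And>g. g \<in> G \<Longrightarrow> norm g \<le> R"
      using bounded_G by (auto simp: bounded_iff)
    have l: "norm (real_vec l) > 0"
      using assms real_vec_eq_iff[of l 0] by simp
    let ?P = "\<lambda>n. g - real n *\<^sub>R real_vec l \<in> G"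
    have bound: "real n * norm (real_vec l) \<le> R + norm g" if "?P n" for n
      using R[OF that] norm_triangle_ineq2[of "real n *\<^sub>R real_vec l" g]
      by (simp add: norm_minus_commute)
    have "\<exists>m. \<not> ?P m"
    proof -
      obtain m where "R + norm g < real m * norm (real_vec l)"
        using reals_Archimedean3[OF l] by blast
      then have "\<not> ?P m" using bound[of m] by linarith
      then show ?thesis by blast
    qed
    then obtain m where m: "\<not> ?P m" "\<And>i. i < m \<Longrightarrow> ?P i"
      using exists_least_iff[of "\<lambda>n. \<not> ?P n"] by blast
    have "m \<noteq> 0" using m(1) kg by (cases m) auto
    then obtain n where n: "m = Suc n" using not0_implies_Suc by blast
    \<comment> \<open>the last point of the walk from g in steps of -l that lies in G\<close>
    define h where "h = g - real n *\<^sub>R real_vec l"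
    have "h \<in> G" using m(2)[of n] n by (simp add: h_def)
    moreover have "h - real_vec l \<notin> G"
      using m(1) n by (simp add: h_def algebra_simps)
    then have "h \<notin> (+) (real_vec l) ` G" by force
    moreover have "x = real_vec (k + int n *s l) + h"
      unfolding kg(1) h_def real_vec_add by (simp add: real_vec_def vec_eq_iff)
    ultimately show "\<exists>k. \<exists>h\<in>G - ?Q. x = real_vec k + h" by blast
  qed
  also have "measure lebesgue (G - ?Q) = 1 - measure lebesgue ?Q"
    using measurable_measure_Diff[OF lmeasurable_G fmeasurableD[OF Q]] measure_G by simp
  finally have "measure lebesgue ?Q = 0"
    using measure_nonneg[of lebesgue ?Q] by linarith
  then show ?thesis
    using Q by (simp add: negligible_iff_measure0)
qed

text \<open>Every point of the tile lies in copies M^(-n)(e + G) of the tile inside G, of arbitrarily small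
diameter. This gives the tile positive measure near each of its points.\<close>

lemma small_subtile:
  assumes "g \<in> G"
  shows "\<exists>e. (\<exists>y\<in>G. g = (contract ^^ n) (real_vec e + y)) \<and>
             (\<forall>y\<in>G. (contract ^^ n) (real_vec e + y) \<in> G)"
proof (induction n)
  case 0
  show ?case using assms by (intro exI[of _ 0]) simp
next
  case (Suc n)
  then obtain e y where e: "y \<in> G" "g = (contract ^^ n) (real_vec e + y)"
      "\<And>y. y \<in> G \<Longrightarrow> (contract ^^ n) (real_vec e + y) \<in> G"
    by blast
  obtain d z where d: "d \<in> D" "z \<in> G" "y = contract (real_vec d + z)"
    using digit_attractor_decompose[OF finite_D e(1)] by blast
  have shift: "(contract ^^ Suc n) (real_vec (M *v e + d) + w)
      = (contract ^^ n) (real_vec e + contract (real_vec d + w))" for w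
    unfolding contract_pow_Suc by (simp add: real_vec_add real_vec_mult contract_add add.assoc)
  have "g = (contract ^^ Suc n) (real_vec (M *v e + d) + z)"
    using e d shift by metis
  moreover have "(contract ^^ Suc n) (real_vec (M *v e + d) + w) \<in> G" if "w \<in> G" for w
    unfolding shift by (intro e(3) digit_attractor_compose d(1) that)
  ultimately show ?case using d(2) by blast
qed

lemma not_negligible_contracted_tile: "\<not> negligible ((\<lambda>y. (contract ^^ n) (a + y)) ` G)"
proof
  let ?N = "(\<lambda>y. (contract ^^ n) (a + y)) ` G"
  assume N: "negligible ?N"
  let ?f = "((*v) (real_mat M)) ^^ n"
  have lin: "linear ?f"
  proof (induction n)
    case 0
    show ?case using linear_id by (simp add: id_def)
  next
    case (Suc n)
    show ?case
      unfolding funpow.simps by (rule linear_compose[OF Suc matrix_vector_mul_linear])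
  qed
  have "?f ` ?N = (+) a ` G"
    by (simp add: image_image mult_pow_contract_pow)
  moreover have "negligible (?f ` ?N)"
    using lin by (intro negligible_differentiable_image_negligible N linear_imp_differentiable_on) auto
  ultimately have "negligible G"
    using negligible_translation_rev by metis
  then show False
    using measure_G negligible_imp_measure0 by fastforce
qed

text \<open>If \<phi> is nonzero at a point of b + G, it is nonzero on a small copy of the tile inside b + G, which is
then covered by the translates indexed by \<Omega>. All of them overlap b + G in null sets, but the copy is
not null.\<close>

lemma vanishes_outside_cover:
  fixes \<phi> :: "real ^ 's \<Rightarrow> real"
  assumes cont: "continuous_on UNIV \<phi>" and "finite \<Omega>"
    and supp: "{x. \<phi> x \<noteq> 0} \<subseteq> translates \<Omega> G" and b: "b \<notin> \<Omega>" and g: "g \<in> G"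
  shows "\<phi> (real_vec b + g) = 0"
proof (rule ccontr)
  assume nz: "\<phi> (real_vec b + g) \<noteq> 0"
  have "open {x. \<phi> x \<noteq> 0}"
    by (rule open_Collect_neq[OF cont continuous_on_const])
  then obtain e where e: "e > 0" "ball (real_vec b + g) e \<subseteq> {x. \<phi> x \<noteq> 0}"
    using nz openE by blast
  obtain R where R: "\<And>g. g \<in> G \<Longrightarrow> norm g \<le> R"
    using bounded_G by (auto simp: bounded_iff)
  obtain n where n: "\<And>z. norm z \<le> 2 * R \<Longrightarrow> norm ((contract ^^ n) z) < e"
    using contract_pow_uniform[OF e(1), of "2 * R"] by (auto simp: eventually_sequentially)
  obtain j y where j: "y \<in> G" "g = (contract ^^ n) (real_vec j + y)"
      "\<And>y. y \<in> G \<Longrightarrow> (contract ^^ n) (real_vec j + y) \<in> G"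
    using small_subtile[OF g, of n] by blast
  define P where "P = (\<lambda>w. (contract ^^ n) (real_vec j + w)) ` G"
  have "P \<subseteq> (\<Union>k\<in>\<Omega>. G \<inter> (+) (real_vec (k - b)) ` G)"
  proof
    fix p assume "p \<in> P"
    then obtain w where w: "w \<in> G" "p = (contract ^^ n) (real_vec j + w)"
      by (auto simp: P_def)
    have "norm (y - w) \<le> 2 * R"
      using norm_triangle_ineq4[of y w] R[OF j(1)] R[OF w(1)] by linarith
    then have "norm ((contract ^^ n) (y - w)) < e" by (rule n)
    moreover have "(contract ^^ n) (y - w) = (real_vec b + g) - (real_vec b + p)"
      unfolding j(2) w(2) by (simp add: contract_pow_add contract_pow_diff)
    ultimately have "real_vec b + p \<in> ball (real_vec b + g) e"
      by (simp add: dist_norm)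
    then have "real_vec b + p \<in> translates \<Omega> G"
      using e(2) supp by blast
    then obtain k h where k: "k \<in> \<Omega>" "h \<in> G" "real_vec b + p = real_vec k + h"
      by (auto simp: translates_def)
    then have "p = real_vec (k - b) + h"
      by (simp add: real_vec_diff algebra_simps)
    moreover have "p \<in> G" using j(3) w by simp
    ultimately show "p \<in> (\<Union>k\<in>\<Omega>. G \<inter> (+) (real_vec (k - b)) ` G)"
      using k by blast
  qed
  moreover have "negligible (\<Union>k\<in>\<Omega>. G \<inter> (+) (real_vec (k - b)) ` G)"
    using b \<open>finite \<Omega>\<close> by (intro negligible_Union) (auto intro!: negligible_tile_overlap)
  ultimately have "negligible P"
    by (rule negligible_subset[rotated])
  then show False
    using not_negligible_contracted_tile unfolding P_def by blast
qed

text \<open>A segment of length at most r meets at most N lattice translates of the tile, with N independent of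
its position. Hence a bound \<delta> on the variation of f within each tile, between points whose
difference is parallel to the segment, yields a bound for the two ends of the segment.\<close>

lemma tilewise_oscillation_bound:
  shows "\<exists>N::nat. \<forall>(f :: real ^ 's \<Rightarrow> real) z u \<delta>. continuous_on UNIV f \<longrightarrow> norm u \<le> r \<longrightarrow>
    (\<forall>k. \<forall>g\<in>G. \<forall>h\<in>G. (\<exists>t. g - h = t *\<^sub>R u) \<longrightarrow> \<bar>f (real_vec k + g) - f (real_vec k + h)\<bar> \<le> \<delta>) \<longrightarrow>
    \<bar>f (z + u) - f z\<bar> \<le> real N * \<delta>"
proof -
  obtain R where R: "\<And>g. g \<in> G \<Longrightarrow> norm g \<le> R"
    using bounded_G by (auto simp: bounded_iff)
  obtain N where N: "\<And>z :: real ^ 's. card {k. norm (real_vec k - z) \<le> r + R} \<le> N"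
    using lattice_points_in_ball_bounded by blast
  have "\<bar>f (z + u) - f z\<bar> \<le> real (2 * N) * \<delta>"
    if f: "continuous_on UNIV f" and u: "norm u \<le> r"
      and osc: "\<And>k g h t. g \<in> G \<Longrightarrow> h \<in> G \<Longrightarrow> g - h = t *\<^sub>R u \<Longrightarrow>
                 \<bar>f (real_vec k + g) - f (real_vec k + h)\<bar> \<le> \<delta>"
    for f :: "real ^ 's \<Rightarrow> real" and z u \<delta>
  proof -
    define F where "F = {k. norm (real_vec k - z) \<le> r + R}"
    have "F = {k. real_vec k \<in> cball z (r + R)}"
      by (auto simp: F_def dist_norm norm_minus_commute)
    then have F: "finite F"
      using finite_lattice_points[of "cball z (r + R)"] by simp
    have \<delta>: "\<delta> \<ge> 0"
      using osc[OF zero_in_G zero_in_G, of 0 0] by simp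
    let ?S = "closed_segment (z + u) z"
    have seg: "\<exists>t. 0 \<le> t \<and> t \<le> 1 \<and> p = z + t *\<^sub>R u" if "p \<in> ?S" for p
    proof -
      obtain s where s: "0 \<le> s" "s \<le> 1" "p = (1 - s) *\<^sub>R (z + u) + s *\<^sub>R z"
        using \<open>p \<in> ?S\<close> by (auto simp: in_segment)
      then have "p = z + (1 - s) *\<^sub>R u"
        by (simp add: algebra_simps)
      with s show ?thesis by (intro exI[of _ "1 - s"]) auto
    qed
    have "\<bar>f (z + u) - f z\<bar> \<le> real (card F) * (2 * \<delta>)"
    proof (rule chain_oscillation_bound[where X = "\<lambda>k. (+) (real_vec k) ` G"])
      show "continuous_on ?S f" using f continuous_on_subset by blast
      show "?S \<subseteq> (\<Union>k\<in>F. (+) (real_vec k) ` G)"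
      proof
        fix p assume p: "p \<in> ?S"
        then obtain t where t: "0 \<le> t" "t \<le> 1" "p = z + t *\<^sub>R u" using seg by blast
        obtain k g where kg: "g \<in> G" "p = real_vec k + g"
          using lattice_translates_cover by blast
        have "real_vec k - z = t *\<^sub>R u - g" using kg t by (simp add: algebra_simps)
        then have "norm (real_vec k - z) \<le> t * norm u + norm g"
          using norm_triangle_ineq4[of "t *\<^sub>R u" g] t by simp
        also have "\<dots> \<le> 1 * r + R"
          using t u R[OF kg(1)] by (intro add_mono mult_mono) auto
        finally have "k \<in> F" by (simp add: F_def)
        then show "p \<in> (\<Union>k\<in>F. (+) (real_vec k) ` G)" using kg by blast
      qed
      fix k p q
      assume "p \<in> (+) (real_vec k) ` G" "q \<in> (+) (real_vec k) ` G" "p \<in> ?S" "q \<in> ?S"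
      then obtain g h where gh: "g \<in> G" "h \<in> G" "p = real_vec k + g" "q = real_vec k + h"
        by blast
      obtain s t where "p = z + s *\<^sub>R u" "q = z + t *\<^sub>R u"
        using seg \<open>p \<in> ?S\<close> \<open>q \<in> ?S\<close> by blast
      then have "p - q = (s - t) *\<^sub>R u"
        by (simp add: algebra_simps)
      then have "g - h = (s - t) *\<^sub>R u"
        using gh by simp
      then show "\<bar>f p - f q\<bar> \<le> \<delta>"
        using osc gh by blast
    qed (use F \<delta> in auto)
    also have "\<dots> \<le> real N * (2 * \<delta>)"
      using N[of z] \<delta> by (intro mult_right_mono) (auto simp: F_def)
    finally show ?thesis by simp
  qed
  then show ?thesis by (intro exI[of _ "2 * N"]) blast
qed

end

section \<open>The joint spectral radius of a finite family on a subspace\<close>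

text \<open>Division of n by p with remainder r gives a n \<le> (a p)^(n div p) a r. This is the core of Fekete's
lemma, and it also yields the uniform constant that the limit alone does not.\<close>

lemma submultiplicative_geometric_bound:
  fixes a :: "nat \<Rightarrow> real"
  assumes nonneg: "\<And>n. a n \<ge> 0" and sub: "\<And>m n. a (m + n) \<le> a m * a n"
    and "p > 0" "\<eta> > 0" "a p \<le> \<eta> ^ p"
  shows "\<exists>K>0. \<forall>n. a n \<le> K * \<eta> ^ n"
proof -
  \<comment> \<open>covers all remainders r < p at once; the added 1 makes it positive\<close>
  define K where "K = (\<Sum>r<p. a r / \<eta> ^ r) + 1"
  have pow: "a (q * p + r) \<le> (\<eta> ^ p) ^ q * a r" for q r
  proof (induction q)
    case (Suc q)
    have "a (Suc q * p + r) \<le> a p * a (q * p + r)"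
      using sub[of p "q * p + r"] by (simp add: add.assoc)
    also have "\<dots> \<le> \<eta> ^ p * ((\<eta> ^ p) ^ q * a r)"
      using Suc assms by (intro mult_mono) auto
    finally show ?case by (simp add: mult.assoc)
  qed simp
  have "a n \<le> K * \<eta> ^ n" for n
  proof -
    define r where "r = n mod p"
    have n: "n = n div p * p + r" by (simp add: r_def)
    have "a r / \<eta> ^ r \<le> (\<Sum>r<p. a r / \<eta> ^ r)"
      using assms by (intro member_le_sum) (auto simp: r_def)
    then have K: "a r / \<eta> ^ r \<le> K" by (simp add: K_def)
    have "a n \<le> (\<eta> ^ p) ^ (n div p) * a r"
      using pow n by metis
    also have "\<dots> = \<eta> ^ n * (a r / \<eta> ^ r)"
      using \<open>\<eta> > 0\<close> by (subst (2) n) (simp add: power_add power_mult mult.commute)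
    also have "\<dots> \<le> \<eta> ^ n * K"
      using K assms by (intro mult_left_mono) auto
    finally show ?thesis by (simp add: mult.commute)
  qed
  moreover have "K > 0"
    unfolding K_def using assms by (intro add_nonneg_pos sum_nonneg) auto
  ultimately show ?thesis by blast
qed

lemma root_geometric_tendsto:
  assumes "K > 0" "\<eta> \<ge> 0"
  shows "(\<lambda>n. root n (K * \<eta> ^ n)) \<longlonglongrightarrow> \<eta>"
proof -
  have "(\<lambda>n. root n K * \<eta>) \<longlonglongrightarrow> 1 * \<eta>"
    by (intro tendsto_intros LIMSEQ_root_const assms)
  then have "(\<lambda>n. root n K * \<eta>) \<longlonglongrightarrow> \<eta>" by simp
  moreover have "\<forall>\<^sub>F n in sequentially. root n K * \<eta> = root n (K * \<eta> ^ n)"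
    using eventually_gt_at_top[of 0]
    by eventually_elim (simp add: assms real_root_mult real_root_power_cancel)
  ultimately show ?thesis
    by (rule Lim_transform_eventually)
qed

text \<open>Fekete's lemma in multiplicative form: the roots converge to their infimum over positive indices.
Without convergence the limit that defines the joint spectral radius would be an unspecified value.\<close>

lemma submultiplicative_root_convergent:
  fixes a :: "nat \<Rightarrow> real"
  assumes nonneg: "\<And>n. a n \<ge> 0" and sub: "\<And>m n. a (m + n) \<le> a m * a n"
  shows "convergent (\<lambda>n. root n (a n))"
proof -
  define X where "X n = root n (a n)" for n
  define L where "L = Inf (X ` {0<..})"
  have X0: "X n \<ge> 0" for n
    using nonneg by (cases "n = 0") (auto simp: X_def)
  then have bdd: "bdd_below (X ` {0<..})"
    by (auto intro!: bdd_belowI[of _ 0])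
  have low: "L \<le> X n" if "n > 0" for n
    unfolding L_def using that bdd by (intro cInf_lower) auto
  have L0: "L \<ge> 0"
    unfolding L_def by (rule cInf_greatest) (use X0 in auto)
  have "X \<longlonglongrightarrow> L"
  proof (rule order_tendstoI)
    fix l assume l: "l < L"
    show "\<forall>\<^sub>F n in sequentially. l < X n"
      by (rule eventually_mono[OF eventually_gt_at_top[of 0]]) (use low l less_le_trans in blast)
  next
    fix y assume "L < y"
    then obtain \<eta> where \<eta>: "L < \<eta>" "\<eta> < y" using dense by blast
    then obtain p where p: "p > 0" "X p < \<eta>"
      using cInf_lessD[of "X ` {0<..}" \<eta>] unfolding L_def by auto
    have "a p = X p ^ p"
      using p nonneg by (simp add: X_def)
    then have "a p \<le> \<eta> ^ p"
      using p X0 by (simp add: power_mono)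
    then obtain K where K: "K > 0" "\<And>n. a n \<le> K * \<eta> ^ n"
      using submultiplicative_geometric_bound[of a p \<eta>] assms p \<eta> L0 by auto
    have "\<forall>\<^sub>F n in sequentially. root n (K * \<eta> ^ n) < y"
      using root_geometric_tendsto[of K \<eta>] K \<eta> L0 by (intro order_tendstoD) auto
    then show "\<forall>\<^sub>F n in sequentially. X n < y"
      using eventually_gt_at_top[of 0]
    proof eventually_elim
      case (elim n)
      have "X n \<le> root n (K * \<eta> ^ n)"
        unfolding X_def using elim K by simp
      with elim show ?case by linarith
    qed
  qed
  then show ?thesis
    unfolding X_def by (auto simp: convergent_def)
qed

lemma linear_foldr_comp:
  assumes "\<And>A. A \<in> set As \<Longrightarrow> linear A"
  shows "linear (foldr (\<circ>) As id)"
  using assms by (induction As) (auto intro!: linear_compose linear_id)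

lemma foldr_comp_append: "foldr (\<circ>) (As @ Bs) id = foldr (\<circ>) As id \<circ> foldr (\<circ>) Bs id"
  by (induction As) (auto simp: o_assoc)

lemma bdd_above_norm_on:
  assumes "linear (f :: 'a::euclidean_space \<Rightarrow> 'a)"
  shows "bdd_above ((\<lambda>x. norm (f x)) ` {x \<in> U. norm x \<le> 1})"
proof -
  obtain K where K: "\<And>x. norm (f x) \<le> K * norm x" "K > 0"
    using linear_bounded_pos[OF assms] by blast
  show ?thesis
  proof (rule bdd_aboveI2)
    fix x assume "x \<in> {x \<in> U. norm x \<le> 1}"
    then have "K * norm x \<le> K * 1"
      using K(2) by (intro mult_left_mono) auto
    then show "norm (f x) \<le> K" using K(1)[of x] by linarith
  qed
qed

lemma norm_on_nonneg:
  assumes "linear (f :: 'a::euclidean_space \<Rightarrow> 'a)" "subspace U"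
  shows "0 \<le> norm_on U f"
proof -
  have "0 \<in> {x \<in> U. norm x \<le> 1}"
    using assms by (simp add: subspace_0)
  then have "norm (f 0) \<le> norm_on U f"
    unfolding norm_on_def by (rule cSUP_upper[OF _ bdd_above_norm_on[OF assms(1)]])
  then show ?thesis by (metis norm_ge_zero order_trans)
qed

lemma norm_on_bound:
  assumes "linear (f :: 'a::euclidean_space \<Rightarrow> 'a)" "subspace U" "u \<in> U"
  shows "norm (f u) \<le> norm_on U f * norm u"
proof (cases "u = 0")
  case True
  then show ?thesis using assms linear_0 by auto
next
  case False
  define w where "w = (1 / norm u) *\<^sub>R u"
  have "w \<in> {x \<in> U. norm x \<le> 1}"
    using assms False by (simp add: w_def subspace_scale)
  then have "norm (f w) \<le> norm_on U f"
    unfolding norm_on_def by (rule cSUP_upper[OF _ bdd_above_norm_on[OF assms(1)]])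
  then show ?thesis
    using False by (simp add: w_def linear_scale[OF assms(1)] field_simps)
qed

lemma norm_on_least:
  assumes "subspace U" "\<And>u. u \<in> U \<Longrightarrow> norm u \<le> 1 \<Longrightarrow> norm (f u) \<le> c"
  shows "norm_on U f \<le> c"
proof -
  have "0 \<in> {x \<in> U. norm x \<le> 1}"
    using assms(1) by (simp add: subspace_0)
  then show ?thesis
    unfolding norm_on_def by (intro cSUP_least) (use assms in auto)
qed

locale operator_family =
  fixes U :: "'a::euclidean_space set" and \<A> :: "('a \<Rightarrow> 'a) set"
  assumes subspace: "subspace U"
    and finite: "finite \<A>" and nonempty: "\<A> \<noteq> {}"
    and linear: "A \<in> \<A> \<Longrightarrow> linear A"
    and invariant: "A \<in> \<A> \<Longrightarrow> A ` U \<subseteq> U"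
begin

definition product_norms :: "nat \<Rightarrow> real set" where
  "product_norms k = {norm_on U (foldr (\<circ>) As id) | As. length As = k \<and> set As \<subseteq> \<A>}"

definition max_norm :: "nat \<Rightarrow> real" where
  "max_norm k = Max (product_norms k)"

lemma product_norms_eq_image:
  "product_norms k = (\<lambda>As. norm_on U (foldr (\<circ>) As id)) ` {As. set As \<subseteq> \<A> \<and> length As = k}"
  by (auto simp: product_norms_def)

lemma finite_product_norms: "finite (product_norms k)"
  unfolding product_norms_eq_image by (intro finite_imageI finite_lists_length_eq finite)

lemma product_norms_nonempty: "product_norms k \<noteq> {}"
proof -
  obtain A where "A \<in> \<A>" using nonempty by blast
  then have "replicate k A \<in> {As. set As \<subseteq> \<A> \<and> length As = k}"
    by auto
  then show ?thesis unfolding product_norms_eq_image by blast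
qed

lemma linear_product: "set As \<subseteq> \<A> \<Longrightarrow> linear (foldr (\<circ>) As id)"
  using linear by (intro linear_foldr_comp) auto

lemma product_invariant: "set As \<subseteq> \<A> \<Longrightarrow> u \<in> U \<Longrightarrow> foldr (\<circ>) As id u \<in> U"
  using invariant by (induction As) auto

lemma norm_product_le:
  assumes "set As \<subseteq> \<A>" "u \<in> U"
  shows "norm (foldr (\<circ>) As id u) \<le> norm_on U (foldr (\<circ>) As id) * norm u"
  using norm_on_bound linear_product assms subspace by blast

lemma norm_on_product_nonneg:
  assumes "set As \<subseteq> \<A>"
  shows "0 \<le> norm_on U (foldr (\<circ>) As id)"
  using norm_on_nonneg linear_product assms subspace by blast

lemma norm_le_max_norm:
  assumes "set As \<subseteq> \<A>"
  shows "norm_on U (foldr (\<circ>) As id) \<le> max_norm (length As)"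
  unfolding max_norm_def product_norms_eq_image
  by (intro Max_ge finite_imageI finite_lists_length_eq finite) (use assms in auto)

lemma max_norm_attained:
  obtains As where "length As = k" "set As \<subseteq> \<A>" "max_norm k = norm_on U (foldr (\<circ>) As id)"
  using Max_in[OF finite_product_norms product_norms_nonempty, of k]
  unfolding max_norm_def[symmetric] by (auto simp: product_norms_def)

lemma max_norm_nonneg: "max_norm k \<ge> 0"
  by (metis max_norm_attained norm_on_product_nonneg)

lemma max_norm_submultiplicative: "max_norm (m + n) \<le> max_norm m * max_norm n"
proof -
  obtain As where As: "length As = m + n" "set As \<subseteq> \<A>"
    "max_norm (m + n) = norm_on U (foldr (\<circ>) As id)"
    using max_norm_attained .
  define Bs where "Bs = take m As"
  define Cs where "Cs = drop m As"
  have BC: "As = Bs @ Cs" "length Bs = m" "length Cs = n"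
    using As by (auto simp: Bs_def Cs_def)
  then have sub: "set Bs \<subseteq> \<A>" "set Cs \<subseteq> \<A>" using As by auto
  have "norm_on U (foldr (\<circ>) As id) \<le> max_norm m * max_norm n"
  proof (rule norm_on_least[OF subspace])
    fix u assume u: "u \<in> U" "norm u \<le> 1"
    let ?v = "foldr (\<circ>) Cs id u"
    have "norm (foldr (\<circ>) As id u) = norm (foldr (\<circ>) Bs id ?v)"
      by (simp add: BC(1) foldr_comp_append del: foldr_append)
    also have "\<dots> \<le> norm_on U (foldr (\<circ>) Bs id) * norm ?v"
      by (intro norm_product_le product_invariant sub u)
    also have "\<dots> \<le> max_norm m * (max_norm n * 1)"
    proof (intro mult_mono)
      show "norm_on U (foldr (\<circ>) Bs id) \<le> max_norm m"
        using norm_le_max_norm sub(1) BC by blast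
      have "norm ?v \<le> norm_on U (foldr (\<circ>) Cs id) * norm u"
        by (intro norm_product_le sub u)
      also have "\<dots> \<le> max_norm n * 1"
        using norm_le_max_norm[OF sub(2)] BC u max_norm_nonneg by (intro mult_mono) auto
      finally show "norm ?v \<le> max_norm n * 1" .
    qed (use max_norm_nonneg in auto)
    finally show "norm (foldr (\<circ>) As id u) \<le> max_norm m * max_norm n" by simp
  qed
  then show ?thesis using As by simp
qed

lemma Max_root_product_norms:
  "Max {root k (norm_on U (foldr (\<circ>) As id)) | As. length As = k \<and> set As \<subseteq> \<A>}
     = root k (max_norm k)"
proof -
  have "mono (root k)"
    by (cases "k = 0") (auto intro!: monoI)
  then have "root k (max_norm k) = Max (root k ` product_norms k)"
    unfolding max_norm_def by (intro mono_Max_commute finite_product_norms product_norms_nonempty)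
  also have "root k ` product_norms k
      = {root k (norm_on U (foldr (\<circ>) As id)) | As. length As = k \<and> set As \<subseteq> \<A>}"
    by (auto simp: product_norms_def)
  finally show ?thesis by simp
qed

lemma root_max_norm_tendsto: "(\<lambda>k. root k (max_norm k)) \<longlonglongrightarrow> joint_spectral_radius U \<A>"
  unfolding joint_spectral_radius_def Max_root_product_norms
  using submultiplicative_root_convergent[OF max_norm_nonneg max_norm_submultiplicative]
  by (simp add: convergent_LIMSEQ_iff)

lemma joint_spectral_radius_nonneg: "0 \<le> joint_spectral_radius U \<A>"
proof (rule LIMSEQ_le_const[OF root_max_norm_tendsto])
  have "0 \<le> root k (max_norm k)" for k
    using max_norm_nonneg by (cases "k = 0") auto
  then show "\<exists>N. \<forall>n\<ge>N. 0 \<le> root n (max_norm n)" by blast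
qed

text \<open>Some p has max_norm p \<le> \<eta>^p, and one such p controls all lengths by submultiplicativity.\<close>

lemma product_bound_if_joint_spectral_radius_less:
  assumes "joint_spectral_radius U \<A> < \<eta>"
  obtains K where "K > 0"
    "\<And>As u. set As \<subseteq> \<A> \<Longrightarrow> u \<in> U \<Longrightarrow> norm (foldr (\<circ>) As id u) \<le> K * \<eta> ^ length As * norm u"
proof -
  have \<eta>: "\<eta> > 0" using assms joint_spectral_radius_nonneg by linarith
  have "\<forall>\<^sub>F k in sequentially. root k (max_norm k) < \<eta> \<and> k > 0"
    using order_tendstoD(2)[OF root_max_norm_tendsto assms] eventually_gt_at_top
    by (rule eventually_conj)
  then obtain p where p: "root p (max_norm p) < \<eta>" "p > 0"
    by (auto simp: eventually_sequentially)
  have "max_norm p = root p (max_norm p) ^ p"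
    using p max_norm_nonneg by simp
  also have "\<dots> \<le> \<eta> ^ p"
    using p max_norm_nonneg by (intro power_mono) auto
  finally obtain K where K: "K > 0" "\<And>n. max_norm n \<le> K * \<eta> ^ n"
    using submultiplicative_geometric_bound[OF max_norm_nonneg max_norm_submultiplicative] p \<eta>
    by blast
  show ?thesis
  proof (rule that[OF K(1)])
    fix As u assume As: "set As \<subseteq> \<A>" "u \<in> U"
    have "norm_on U (foldr (\<circ>) As id) * norm u \<le> K * \<eta> ^ length As * norm u"
      using order_trans[OF norm_le_max_norm[OF As(1)] K(2)] by (intro mult_right_mono) auto
    then show "norm (foldr (\<circ>) As id u) \<le> K * \<eta> ^ length As * norm u"
      using norm_product_le[OF As] by linarith
  qed
qed

text \<open>A bound with a constant depending on the vector passes from a spanning set to all of U by linearity,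
and it becomes uniform on the unit ball of U by expansion in a finite orthonormal basis.\<close>

lemma joint_spectral_radius_le_if_spanning_bound:
  assumes \<eta>: "\<eta> \<ge> 0" and U: "U = span S"
    and bound: "\<And>u. u \<in> S \<Longrightarrow>
      \<exists>K. \<forall>As. set As \<subseteq> \<A> \<longrightarrow> norm (foldr (\<circ>) As id u) \<le> K * \<eta> ^ length As"
  shows "joint_spectral_radius U \<A> \<le> \<eta>"
proof -
  let ?P = "\<lambda>u. \<exists>K. \<forall>As. set As \<subseteq> \<A> \<longrightarrow> norm (foldr (\<circ>) As id u) \<le> K * \<eta> ^ length As"
  have P: "?P u" if "u \<in> U" for u
    using that unfolding U
  proof (induction rule: span_induct_alt)
    case base
    have "norm (foldr (\<circ>) As id 0) \<le> 0 * \<eta> ^ length As" if "set As \<subseteq> \<A>" for As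
      using linear_0[OF linear_product[OF that]] by simp
    then show ?case by blast
  next
    case (step c x y)
    obtain K1 where K1: "\<And>As. set As \<subseteq> \<A> \<Longrightarrow> norm (foldr (\<circ>) As id x) \<le> K1 * \<eta> ^ length As"
      using bound[OF step(1)] by blast
    obtain K2 where K2: "\<And>As. set As \<subseteq> \<A> \<Longrightarrow> norm (foldr (\<circ>) As id y) \<le> K2 * \<eta> ^ length As"
      using step(2) by blast
    have "norm (foldr (\<circ>) As id (c *\<^sub>R x + y)) \<le> (\<bar>c\<bar> * K1 + K2) * \<eta> ^ length As"
      if "set As \<subseteq> \<A>" for As
    proof -
      have "foldr (\<circ>) As id (c *\<^sub>R x + y)
              = c *\<^sub>R foldr (\<circ>) As id x + foldr (\<circ>) As id y"
        by (simp add: linear_add[OF linear_product[OF that]] linear_scale[OF linear_product[OF that]])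
      then have "norm (foldr (\<circ>) As id (c *\<^sub>R x + y))
              \<le> \<bar>c\<bar> * norm (foldr (\<circ>) As id x) + norm (foldr (\<circ>) As id y)"
        using norm_triangle_ineq[of "c *\<^sub>R foldr (\<circ>) As id x" "foldr (\<circ>) As id y"] by simp
      also have "\<dots> \<le> \<bar>c\<bar> * (K1 * \<eta> ^ length As) + K2 * \<eta> ^ length As"
        using K1[OF that] K2[OF that] by (intro add_mono mult_left_mono) auto
      finally show ?thesis by (simp add: algebra_simps)
    qed
    then show ?case by blast
  qed
  obtain E where E: "E \<subseteq> U" "pairwise orthogonal E" "\<And>x. x \<in> E \<Longrightarrow> norm x = 1"
    "independent E" "span E = U"
    using orthonormal_basis_subspace[OF subspace] by metis
  have finE: "finite E" using E(4) independent_bound by blast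
  have "\<forall>e\<in>E. ?P e" using P E(1) by blast
  then obtain K where K: "\<And>e As. e \<in> E \<Longrightarrow> set As \<subseteq> \<A> \<Longrightarrow>
      norm (foldr (\<circ>) As id e) \<le> K e * \<eta> ^ length As"
    by metis
  define C where "C = (\<Sum>e\<in>E. \<bar>K e\<bar>) + 1"
  have "C > 0" unfolding C_def by (intro add_nonneg_pos sum_nonneg) auto
  have "norm_on U (foldr (\<circ>) As id) \<le> C * \<eta> ^ length As" if As: "set As \<subseteq> \<A>" for As
  proof (rule norm_on_least[OF subspace])
    fix u assume u: "u \<in> U" "norm u \<le> 1"
    let ?f = "foldr (\<circ>) As id"
    have "u = (\<Sum>e\<in>E. (u \<bullet> e) *\<^sub>R e)"
      using orthonormal_basis_expand[OF E(2,3) _ finE] u E(5) by simp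
    then have "?f u = ?f (\<Sum>e\<in>E. (u \<bullet> e) *\<^sub>R e)"
      by simp
    also have "\<dots> = (\<Sum>e\<in>E. (u \<bullet> e) *\<^sub>R ?f e)"
      using linear_product[OF As] by (simp add: linear_sum linear_scale)
    finally have "norm (?f u) \<le> (\<Sum>e\<in>E. \<bar>u \<bullet> e\<bar> * norm (?f e))"
      by (metis (mono_tags, lifting) norm_scaleR norm_sum sum.cong)
    also have "\<dots> \<le> (\<Sum>e\<in>E. 1 * (\<bar>K e\<bar> * \<eta> ^ length As))"
    proof (intro sum_mono mult_mono)
      fix e assume e: "e \<in> E"
      show "\<bar>u \<bullet> e\<bar> \<le> 1"
        using Cauchy_Schwarz_ineq2[of u e] E(3)[OF e] u by simp
      have "K e * \<eta> ^ length As \<le> \<bar>K e\<bar> * \<eta> ^ length As"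
        using \<eta> by (intro mult_right_mono) auto
      then show "norm (?f e) \<le> \<bar>K e\<bar> * \<eta> ^ length As"
        using K[OF e As] by linarith
    qed auto
    also have "\<dots> \<le> C * \<eta> ^ length As"
      using \<eta> by (simp add: C_def sum_distrib_right[symmetric] algebra_simps)
    finally show "norm (?f u) \<le> C * \<eta> ^ length As" .
  qed
  then have "max_norm k \<le> C * \<eta> ^ k" for k
    by (metis max_norm_attained)
  then have "root k (max_norm k) \<le> root k (C * \<eta> ^ k)" if "k > 0" for k
    using that by simp
  then show ?thesis
    by (intro LIMSEQ_le[OF root_max_norm_tendsto root_geometric_tendsto[OF \<open>C > 0\<close> \<eta>]])
       (auto intro!: exI[of _ 1])
qed

end

section \<open>Regularity of continuous refinable functions\<close>

text \<open>A telescoping sum. It turns local estimates into periods: when a fixed displacement is split into m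
equal steps and the bound e for one step decays faster than 1/m, the displacement is a period.\<close>

lemma translation_steps:
  fixes \<phi> :: "'a::real_vector \<Rightarrow> real"
  assumes "\<And>x. \<bar>\<phi> (x + s) - \<phi> x\<bar> \<le> e"
  shows "\<bar>\<phi> (x + real m *\<^sub>R s) - \<phi> x\<bar> \<le> real m * e"
proof (induction m)
  case (Suc m)
  have "\<phi> (x + real (Suc m) *\<^sub>R s) = \<phi> ((x + real m *\<^sub>R s) + s)"
    by (simp add: algebra_simps)
  then show ?case
    using Suc assms[of "x + real m *\<^sub>R s"] by (simp add: algebra_simps)
qed simp

lemma periodic_bounded_support_imp_zero:
  fixes \<phi> :: "'a::real_normed_vector \<Rightarrow> real"
  assumes "bounded {x. \<phi> x \<noteq> 0}" "h \<noteq> 0" "\<And>x. \<phi> (x + h) = \<phi> x"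
  shows "\<phi> = (\<lambda>x. 0)"
proof (rule ext, rule ccontr)
  fix x assume x: "\<phi> x \<noteq> 0"
  obtain R where R: "\<And>x. \<phi> x \<noteq> 0 \<Longrightarrow> norm x \<le> R"
    using assms(1) by (auto simp: bounded_iff)
  obtain n where n: "R + norm x < real n * norm h"
    using reals_Archimedean3[of "norm h"] assms(2) by auto
  have "\<bar>\<phi> (x + real n *\<^sub>R h) - \<phi> x\<bar> \<le> real n * 0"
    by (rule translation_steps) (simp add: assms(3))
  then have "norm (x + real n *\<^sub>R h) \<le> R"
    using x by (intro R) auto
  then show False
    using n norm_triangle_ineq2[of "real n *\<^sub>R h" "- x"] by (simp add: add.commute)
qed

lemma zero_if_geometric_bound:
  assumes "0 \<le> q" "q < 1" "\<And>n. \<bar>d\<bar> \<le> C * q ^ n"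
  shows "d = (0::real)"
proof -
  have "(\<lambda>n. C * q ^ n) \<longlonglongrightarrow> 0"
    using assms by (intro tendsto_mult_right_zero LIMSEQ_power_zero) auto
  then have "\<bar>d\<bar> \<le> 0"
    by (rule LIMSEQ_le_const) (use assms(3) in blast)
  then show ?thesis by simp
qed

text \<open>An exponent \<alpha> > 1 would make \<phi> constant: n steps of length 1/n change \<phi> by at most
O(n^(1 - \<alpha>)).\<close>

lemma holder_exponent_Lipschitz:
  fixes \<phi> :: "'a::euclidean_space \<Rightarrow> real"
  assumes lip: "L-lipschitz_on UNIV \<phi>" and supp: "bounded {x. \<phi> x \<noteq> 0}" and nz: "\<phi> \<noteq> (\<lambda>x. 0)"
  shows "holder_exponent \<phi> = 1"
  unfolding holder_exponent_def
proof (rule antisym)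
  have "\<bar>\<phi> (x + h) - \<phi> x\<bar> \<le> L * norm h powr 1" for h x
    using lipschitz_onD[OF lip, of "x + h" x] by (simp add: dist_norm)
  then show "1 \<le> Sup {ereal \<alpha> |\<alpha>. 0 \<le> \<alpha> \<and> (\<exists>C. \<forall>h x. \<bar>\<phi> (x + h) - \<phi> x\<bar> \<le> C * norm h powr \<alpha>)}"
    by (intro Sup_upper CollectI exI[of _ 1] conjI exI[of _ L]) (auto simp: one_ereal_def)
next
  show "Sup {ereal \<alpha> |\<alpha>. 0 \<le> \<alpha> \<and> (\<exists>C. \<forall>h x. \<bar>\<phi> (x + h) - \<phi> x\<bar> \<le> C * norm h powr \<alpha>)} \<le> 1"
  proof (rule Sup_least, clarsimp)
    fix \<alpha> C assume C: "\<forall>h x. \<bar>\<phi> (x + h) - \<phi> x\<bar> \<le> C * norm h powr \<alpha>"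
    show "\<alpha> \<le> 1"
    proof (rule ccontr)
      assume \<alpha>: "\<not> \<alpha> \<le> 1"
      obtain h :: 'a where h: "h \<in> Basis" using nonempty_Basis by blast
      have h1: "norm h = 1" using h by simp
      have "\<phi> (x + h) = \<phi> x" for x
      proof -
        have bound: "\<bar>\<phi> (x + h) - \<phi> x\<bar> \<le> C * real n powr (1 - \<alpha>)" if n: "n \<ge> 1" for n
        proof -
          have "\<bar>\<phi> (x + real n *\<^sub>R ((1 / real n) *\<^sub>R h)) - \<phi> x\<bar> \<le> real n * (C * (1 / real n) powr \<alpha>)"
          proof (rule translation_steps)
            fix y
            show "\<bar>\<phi> (y + (1 / real n) *\<^sub>R h) - \<phi> y\<bar> \<le> C * (1 / real n) powr \<alpha>"
              using C[rule_format, of y "(1 / real n) *\<^sub>R h"] h1 by simp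
          qed
          also have "real n * (C * (1 / real n) powr \<alpha>) = C * real n powr (1 - \<alpha>)"
            using n by (simp add: powr_diff powr_divide)
          finally show ?thesis using n by simp
        qed
        have "(\<lambda>n. real n powr (1 - \<alpha>)) \<longlonglongrightarrow> 0"
          using \<alpha> by (intro tendsto_neg_powr filterlim_real_sequentially) simp
        then have "(\<lambda>n. C * real n powr (1 - \<alpha>)) \<longlonglongrightarrow> 0"
          by (rule tendsto_mult_right_zero)
        then have "\<bar>\<phi> (x + h) - \<phi> x\<bar> \<le> 0"
          by (rule LIMSEQ_le_const) (use bound in blast)
        then show ?thesis by simp
      qed
      then have "\<phi> = (\<lambda>x. 0)"
        using h1 by (intro periodic_bounded_support_imp_zero[OF supp, of h]) auto
      with nz show False by contradiction
    qed
  qed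
qed

text \<open>The operator norm bounds the moduli of the eigenvalues, so their supremum is a genuine upper
bound.\<close>

lemma cmod_eigenvalue_le_spectral_radius:
  fixes M :: "int ^ 's ^ 's"
  assumes "z \<in> eigenvalues M"
  shows "cmod z \<le> spectral_radius M"
proof -
  let ?C = "map_matrix complex_of_int M"
  have "linear ((*v) ?C)"
  proof (rule linearI)
    show "?C *v (x + y) = ?C *v x + ?C *v y" for x y
      by (rule matrix_vector_right_distrib)
    show "?C *v (r *\<^sub>R x) = r *\<^sub>R (?C *v x)" for r x
      by (simp add: matrix_vector_mult_def vec_eq_iff scaleR_sum_right)
  qed
  then obtain K where K: "\<And>u. norm (?C *v u) \<le> K * norm u"
    using linear_bounded by blast
  have "cmod w \<le> K" if w: "w \<in> eigenvalues M" for w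
  proof -
    obtain u where u: "u \<noteq> 0" "?C *v u = w *s u"
      using w by (auto simp: eigenvalues_def)
    then have "cmod w * norm u \<le> K * norm u"
      using K[of u] by (simp add: norm_vector_scale_complex)
    then show ?thesis using u by simp
  qed
  then have "bdd_above (cmod ` eigenvalues M)"
    by (intro bdd_aboveI2)
  then show ?thesis
    unfolding spectral_radius_def using assms by (intro cSup_upper) auto
qed

lemma norm_Re_vec_le: "norm (Re_vec u) \<le> norm u"
  unfolding norm_vec_def Re_vec_def
  by (intro L2_set_mono) (simp_all add: abs_Re_le_cmod)

text \<open>For a complex eigenvector u of M, this is the real invariant subspace spanned by its real and
imaginary parts.\<close>

definition eigen_directions :: "complex ^ 's \<Rightarrow> (real ^ 's) set" where
  "eigen_directions u = range (\<lambda>w. Re_vec (w *s u))"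

lemma eigen_directions_nonzero:
  assumes "u \<noteq> 0"
  obtains h where "h \<in> eigen_directions u" "h \<noteq> 0"
proof -
  obtain i where i: "u $ i \<noteq> 0" using assms by (auto simp: vec_eq_iff)
  have "Re_vec (cnj (u $ i) *s u) $ i = (cmod (u $ i))\<^sup>2"
    by (simp add: Re_vec_def cmod_def power2_eq_square)
  then have "Re_vec (cnj (u $ i) *s u) \<noteq> 0"
    using i by (metis norm_eq_zero power_eq_0_iff zero_index)
  then show ?thesis using that by (auto simp: eigen_directions_def)
qed

lemma scaleR_eigen_directions:
  assumes "h \<in> eigen_directions u"
  shows "t *\<^sub>R h \<in> eigen_directions u"
proof -
  obtain w where "h = Re_vec (w *s u)" using assms by (auto simp: eigen_directions_def)
  moreover have "t *\<^sub>R Re_vec (w *s u) = Re_vec ((of_real t * w) *s u)"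
    by (simp add: Re_vec_def vec_eq_iff algebra_simps)
  ultimately show ?thesis by (auto simp: eigen_directions_def)
qed

locale continuous_refinable = digit_tile M D for M :: "int ^ 's ^ 's" and D +
  fixes c :: "int ^ 's \<Rightarrow> real" and \<phi> :: "real ^ 's \<Rightarrow> real" and \<omega> :: "'n::finite \<Rightarrow> int ^ 's"
  assumes finite_mask: "finite (seq_supp c)" and inj_\<omega>: "inj \<omega>"
    and cover: "digit_attractor M (seq_supp c) \<subseteq> translates (range \<omega>) (digit_attractor M D)"
    and refinable: "refinable_function M c \<phi>"
begin

abbreviation v :: "real ^ 's \<Rightarrow> real ^ 'n" where
  "v \<equiv> shift_vector \<phi> \<omega>"

abbreviation T :: "int ^ 's \<Rightarrow> real ^ 'n \<Rightarrow> real ^ 'n" where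
  "T d \<equiv> (*v) (transition_matrix M c \<omega> d)"

definition transitions :: "(real ^ 'n \<Rightarrow> real ^ 'n) set" where
  "transitions = T ` D"

lemma continuous_\<phi>: "continuous_on UNIV \<phi>"
  using refinable unfolding refinable_function_def by blast

lemma refinement: "\<phi> x = (\<Sum>k\<in>seq_supp c. c k * \<phi> (real_mat M *v x - real_vec k))"
  using refinable unfolding refinable_function_def by blast

lemma bounded_support: "bounded {x. \<phi> x \<noteq> 0}"
proof -
  have "bounded (closure {x. \<phi> x \<noteq> 0})"
    using refinable unfolding refinable_function_def by (intro compact_imp_bounded) blast
  then show ?thesis using closure_subset bounded_subset by blast
qed

lemma support_subset: "{x. \<phi> x \<noteq> 0} \<subseteq> digit_attractor M (seq_supp c)"
proof (rule subset_digit_attractor[OF bounded_support])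
  fix x assume "x \<in> {x. \<phi> x \<noteq> 0}"
  then have "(\<Sum>k\<in>seq_supp c. c k * \<phi> (real_mat M *v x - real_vec k)) \<noteq> 0"
    unfolding refinement[of x, symmetric] by simp
  then obtain k where "k \<in> seq_supp c" "c k * \<phi> (real_mat M *v x - real_vec k) \<noteq> 0"
    using sum.not_neutral_contains_not_neutral by blast
  then show "\<exists>d\<in>seq_supp c. \<exists>y\<in>{x. \<phi> x \<noteq> 0}. x = contract (real_vec d + y)"
    by (intro bexI[of _ k] bexI[of _ "real_mat M *v x - real_vec k"]) auto
qed

lemma vanishes: "b \<notin> range \<omega> \<Longrightarrow> g \<in> G \<Longrightarrow> \<phi> (real_vec b + g) = 0"
  by (rule vanishes_outside_cover[OF continuous_\<phi>, of "range \<omega>"]) (use support_subset cover in auto)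

text \<open>The refinement equation at M^(-1)(d + y) + \<omega> a, with the summation index replaced by the argument
b = M \<omega> a + d - k. Terms with b outside the range of \<omega> vanish because \<phi> does on b + G.\<close>

lemma transition_shift_vector:
  assumes "y \<in> G"
  shows "T d (v y) = v (contract (real_vec d + y))"
proof -
  have "(T d (v y)) $ a = \<phi> (contract (real_vec d + y) + real_vec (\<omega> a))" for a
  proof -
    define j where "j = M *v \<omega> a + d"
    have arg: "real_mat M *v (contract (real_vec d + y) + real_vec (\<omega> a)) = real_vec j + y"
      by (simp add: matrix_vector_right_distrib real_vec_add real_vec_mult j_def)
    have "\<phi> (contract (real_vec d + y) + real_vec (\<omega> a))
        = (\<Sum>k\<in>seq_supp c. c k * \<phi> (real_vec j + y - real_vec k))"
      by (subst refinement) (simp only: arg)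
    also have "\<dots> = (\<Sum>b\<in>(\<lambda>k. j - k) ` seq_supp c. c (j - b) * \<phi> (real_vec b + y))"
      by (subst sum.reindex) (auto simp: inj_on_def real_vec_diff algebra_simps)
    also have "\<dots> = (\<Sum>b\<in>range \<omega>. c (j - b) * \<phi> (real_vec b + y))"
    proof (rule sum.mono_neutral_cong)
      fix b assume b: "b \<in> range \<omega> - (\<lambda>k. j - k) ` seq_supp c"
      have "j - b \<notin> seq_supp c"
      proof
        assume "j - b \<in> seq_supp c"
        then have "j - (j - b) \<in> (\<lambda>k. j - k) ` seq_supp c" by blast
        with b show False by simp
      qed
      then show "c (j - b) * \<phi> (real_vec b + y) = 0" by (simp add: seq_supp_def)
    qed (use finite_mask vanishes assms in auto)
    also have "\<dots> = (\<Sum>b\<in>UNIV. c (j - \<omega> b) * \<phi> (real_vec (\<omega> b) + y))"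
      by (simp add: sum.reindex[OF inj_\<omega>])
    also have "\<dots> = (T d (v y)) $ a"
      by (simp add: matrix_vector_mult_def transition_matrix_def shift_vector_def j_def algebra_simps)
    finally show ?thesis by simp
  qed
  then show ?thesis
    by (simp add: vec_eq_iff shift_vector_def)
qed

definition U :: "(real ^ 'n) set" where
  "U = difference_space G \<phi> \<omega>"

lemma difference_in_U: "g \<in> G \<Longrightarrow> h \<in> G \<Longrightarrow> v g - v h \<in> U"
  unfolding U_def difference_space_def by (rule span_base) blast

lemma transition_difference:
  assumes "x \<in> G" "y \<in> G"
  shows "T d (v y - v x) = v (contract (real_vec d + y)) - v (contract (real_vec d + x))"
  using assms by (simp add: matrix_vector_mult_diff_distrib transition_shift_vector)

text \<open>Invariance of a span need only be checked on its generators; used for U and for its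
subspace of directional differences.\<close>

lemma transition_invariant_span:
  assumes "A \<in> transitions" and "\<And>d s. d \<in> D \<Longrightarrow> s \<in> S \<Longrightarrow> T d s \<in> span S"
  shows "A ` span S \<subseteq> span S"
proof -
  obtain d where d: "d \<in> D" "A = T d" using assms(1) by (auto simp: transitions_def)
  have "A ` span S = span (A ` S)"
    unfolding d by (simp add: linear_span_image)
  also have "\<dots> \<subseteq> span S"
    by (rule span_minimal) (use assms(2) d in auto)
  finally show ?thesis .
qed

sublocale operator_family U transitions
proof (rule operator_family.intro)
  show "subspace U" by (simp add: U_def difference_space_def)
  show "finite transitions" using finite_D by (simp add: transitions_def)
  show "transitions \<noteq> {}" using zero_digit by (auto simp: transitions_def)
  show "linear A" if "A \<in> transitions" for A
    using that by (auto simp: transitions_def)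
  show "A ` U \<subseteq> U" if "A \<in> transitions" for A
    unfolding U_def difference_space_def
  proof (rule transition_invariant_span[OF that])
    fix d s
    assume d: "d \<in> D" and "s \<in> {v y - v x |x y. x \<in> G \<and> y \<in> G}"
    then obtain x y where xy: "s = v y - v x" "x \<in> G" "y \<in> G" by blast
    then have "T d s = v (contract (real_vec d + y)) - v (contract (real_vec d + x))"
      using transition_difference by simp
    moreover have "contract (real_vec d + y) \<in> G" "contract (real_vec d + x) \<in> G"
      using d xy by (auto intro: digit_attractor_compose)
    ultimately show "T d s \<in> span {v y - v x |x y. x \<in> G \<and> y \<in> G}"
      by (intro span_base) blast
  qed
qed

text \<open>A product of n transition matrices acts on shift vectors as an affine contraction of the tile with
linear part M^(-n). The translation a does not depend on the point, so it cancels in differences.\<close>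

lemma product_shift_vector:
  assumes "set As \<subseteq> transitions"
  shows "\<exists>a. \<forall>g\<in>G. (contract ^^ length As) g + a \<in> G \<and>
    foldr (\<circ>) As id (v g) = v ((contract ^^ length As) g + a)"
  using assms
proof (induction As)
  case Nil
  show ?case by (intro exI[of _ 0]) simp
next
  case (Cons A As)
  then have "set As \<subseteq> transitions" by simp
  from Cons.IH[OF this] obtain a where a: "\<And>g. g \<in> G \<Longrightarrow> (contract ^^ length As) g + a \<in> G"
      "\<And>g. g \<in> G \<Longrightarrow> foldr (\<circ>) As id (v g) = v ((contract ^^ length As) g + a)"
    by blast
  obtain d where d: "d \<in> D" "A = T d" using Cons by (auto simp: transitions_def)
  have eq: "contract (real_vec d + ((contract ^^ length As) g + a))
      = (contract ^^ length (A # As)) g + contract (real_vec d + a)" for g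
    by (simp add: contract_add algebra_simps)
  show ?case
  proof (intro exI[of _ "contract (real_vec d + a)"] ballI)
    fix g assume g: "g \<in> G"
    have "(contract ^^ length (A # As)) g + contract (real_vec d + a) \<in> G"
      unfolding eq[symmetric] by (intro digit_attractor_compose d a(1) g)
    moreover have "foldr (\<circ>) (A # As) id (v g)
        = v ((contract ^^ length (A # As)) g + contract (real_vec d + a))"
      unfolding eq[symmetric] by (simp add: a(2)[OF g] d transition_shift_vector[OF a(1)[OF g]])
    ultimately show "(contract ^^ length (A # As)) g + contract (real_vec d + a) \<in> G \<and>
        foldr (\<circ>) (A # As) id (v g) = v ((contract ^^ length (A # As)) g + contract (real_vec d + a))"
      by blast
  qed
qed

text \<open>Repeated division of j by M: on the small tile M^(-n)(j + G) the values of \<phi> are, up to an integer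
translation a, those on G after one fixed product of n transition matrices.\<close>

lemma contracted_tile_products:
  "\<exists>a As. set As \<subseteq> transitions \<and> length As = n \<and>
     (\<forall>g\<in>G. \<exists>h\<in>G. (contract ^^ n) (real_vec j + g) = real_vec a + h \<and>
                   v h = foldr (\<circ>) As id (v g))"
proof (induction n arbitrary: j)
  case 0
  show ?case by (intro exI[of _ j] exI[of _ "[]"]) auto
next
  case (Suc n)
  obtain d y where dy: "d \<in> D"
    "\<And>g. contract (real_vec j + g) = real_vec y + contract (real_vec d + g)"
    using lattice_division[of j] by metis
  obtain a As where As: "set As \<subseteq> transitions" "length As = n"
    "\<And>g. g \<in> G \<Longrightarrow> \<exists>h\<in>G. (contract ^^ n) (real_vec y + g) = real_vec a + h \<and>
                   v h = foldr (\<circ>) As id (v g)"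
    using Suc[of y] by blast
  have "\<exists>h\<in>G. (contract ^^ Suc n) (real_vec j + g) = real_vec a + h \<and>
                   v h = foldr (\<circ>) (As @ [T d]) id (v g)" if g: "g \<in> G" for g
  proof -
    have "contract (real_vec d + g) \<in> G"
      by (intro digit_attractor_compose dy g)
    from As(3)[OF this] show ?thesis
      unfolding contract_pow_Suc dy(2) foldr_comp_append by (simp add: transition_shift_vector[OF g])
  qed
  moreover have "set (As @ [T d]) \<subseteq> transitions" "length (As @ [T d]) = Suc n"
    using As(1,2) dy(1) by (auto simp: transitions_def)
  ultimately show ?case by blast
qed

lemma \<phi>_difference_le:
  assumes "g \<in> G" "h \<in> G"
  shows "\<bar>\<phi> (real_vec a + g) - \<phi> (real_vec a + h)\<bar> \<le> norm (v g - v h)"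
proof (cases "a \<in> range \<omega>")
  case True
  then obtain i where i: "a = \<omega> i" by blast
  have "\<bar>(v g - v h) $ i\<bar> \<le> norm (v g - v h)"
    by (rule component_le_norm_cart)
  then show ?thesis by (simp add: i shift_vector_def add.commute)
qed (use vanishes assms in simp)

lemma bounded_shift_vectors: "\<exists>\<Delta>. \<forall>g\<in>G. \<forall>h\<in>G. norm (v g - v h) \<le> \<Delta>"
proof -
  have "continuous_on UNIV (\<lambda>x. \<phi> (x + real_vec (\<omega> a)))" for a
    by (rule continuous_on_compose2[OF continuous_\<phi>]) (auto intro: continuous_intros)
  then have "continuous_on G v"
    unfolding shift_vector_def
    by (intro continuous_on_vec_lambda) (blast intro: continuous_on_subset)
  then have "bounded (v ` G)"
    using bounded_G closed_G
    by (intro compact_imp_bounded compact_continuous_image) (simp_all add: compact_eq_bounded_closed)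
  then obtain B where B: "\<And>g. g \<in> G \<Longrightarrow> norm (v g) \<le> B"
    by (auto simp: bounded_iff)
  have "norm (v g - v h) \<le> 2 * B" if "g \<in> G" "h \<in> G" for g h
    using norm_triangle_ineq4[of "v g" "v h"] B[OF that(1)] B[OF that(2)] by linarith
  then show ?thesis by blast
qed

text \<open>The products cannot decay faster than the powers of M^(-1) do in a single eigendirection: otherwise \<phi>
would have a period in that direction.\<close>

theorem joint_spectral_radius_ge:
  assumes \<mu>: "\<mu> \<in> eigenvalues M" and nz: "\<phi> \<noteq> (\<lambda>x. 0)"
  shows "1 / cmod \<mu> \<le> joint_spectral_radius U transitions"
proof (rule ccontr)
  assume "\<not> ?thesis"
  then obtain \<eta> where \<eta>: "joint_spectral_radius U transitions < \<eta>" "\<eta> < 1 / cmod \<mu>"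
    using dense not_le by blast
  have \<eta>0: "\<eta> > 0" using \<eta>(1) joint_spectral_radius_nonneg by linarith
  obtain K where K: "K > 0" "\<And>As u. set As \<subseteq> transitions \<Longrightarrow> u \<in> U \<Longrightarrow>
      norm (foldr (\<circ>) As id u) \<le> K * \<eta> ^ length As * norm u"
    using product_bound_if_joint_spectral_radius_less[OF \<eta>(1)] by blast
  have \<mu>1: "cmod \<mu> > 1" using \<mu> expansive by (auto simp: expansive_def)
  obtain u where u: "u \<noteq> 0" "map_matrix of_int M *v u = \<mu> *s u"
    using \<mu> by (auto simp: eigenvalues_def)
  obtain w where w: "Re_vec (w *s u) \<noteq> 0"
    using eigen_directions_nonzero[OF u(1)] by (auto simp: eigen_directions_def)
  define h where "h = Re_vec (w *s u)"
  obtain N :: nat where N: "\<And>(f :: real ^ 's \<Rightarrow> real) z s \<delta>. continuous_on UNIV f \<Longrightarrow> norm s \<le> norm (w *s u) \<Longrightarrow>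
    (\<And>k g h. g \<in> G \<Longrightarrow> h \<in> G \<Longrightarrow> \<bar>f (real_vec k + g) - f (real_vec k + h)\<bar> \<le> \<delta>) \<Longrightarrow>
    \<bar>f (z + s) - f z\<bar> \<le> real N * \<delta>"
    using tilewise_oscillation_bound[of "norm (w *s u)"] by metis
  obtain \<Delta> where \<Delta>: "\<And>g h. g \<in> G \<Longrightarrow> h \<in> G \<Longrightarrow> norm (v g - v h) \<le> \<Delta>"
    using bounded_shift_vectors by blast
  have \<Delta>0: "\<Delta> \<ge> 0" using \<Delta>[OF zero_in_G zero_in_G] by simp
  define C where "C = real N * (K * \<Delta>)"
  have C0: "C \<ge> 0" using K \<Delta>0 by (simp add: C_def)
  have step: "\<bar>\<phi> (x + (contract ^^ n) s) - \<phi> x\<bar> \<le> C * \<eta> ^ n" if s: "norm s \<le> norm (w *s u)" for x s n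
  proof -
    \<comment> \<open>rescaled by M^n, the short displacement becomes s and the small tiles become unit tiles\<close>
    define f where "f = \<phi> \<circ> (contract ^^ n)"
    define z where "z = (((*v) (real_mat M)) ^^ n) x"
    have "continuous_on UNIV (contract ^^ n)"
      by (rule linear_continuous_on) (simp add: linear_contract_pow linear_conv_bounded_linear[symmetric])
    then have "continuous_on UNIV f"
      unfolding f_def by (rule continuous_on_compose) (rule continuous_on_subset[OF continuous_\<phi>], simp)
    moreover have "\<bar>f (real_vec k + g) - f (real_vec k + g')\<bar> \<le> K * \<eta> ^ n * \<Delta>"
      if g: "g \<in> G" "g' \<in> G" for k g g'
    proof -
      obtain a As where As: "set As \<subseteq> transitions" "length As = n"
        "\<And>g. g \<in> G \<Longrightarrow> \<exists>h\<in>G. (contract ^^ n) (real_vec k + g) = real_vec a + h \<and>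
                   v h = foldr (\<circ>) As id (v g)"
        using contracted_tile_products[of n k] by blast
      obtain h where h: "h \<in> G" "(contract ^^ n) (real_vec k + g) = real_vec a + h"
          "v h = foldr (\<circ>) As id (v g)"
        using As(3)[OF g(1)] by blast
      obtain h' where h': "h' \<in> G" "(contract ^^ n) (real_vec k + g') = real_vec a + h'"
          "v h' = foldr (\<circ>) As id (v g')"
        using As(3)[OF g(2)] by blast
      have "\<bar>f (real_vec k + g) - f (real_vec k + g')\<bar> \<le> norm (v h - v h')"
        using \<phi>_difference_le[OF h(1) h'(1), of a] by (simp add: f_def h(2) h'(2))
      also have "v h - v h' = foldr (\<circ>) As id (v g - v g')"
        by (simp add: h(3) h'(3) linear_diff[OF linear_product[OF As(1)]])
      also have "norm \<dots> \<le> K * \<eta> ^ n * norm (v g - v g')"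
        using K(2)[OF As(1) difference_in_U[OF g]] As(2) by simp
      also have "\<dots> \<le> K * \<eta> ^ n * \<Delta>"
        using K(1) \<eta>0 \<Delta>[OF g] by (intro mult_left_mono) auto
      finally show ?thesis .
    qed
    ultimately have "\<bar>f (z + s) - f z\<bar> \<le> real N * (K * \<eta> ^ n * \<Delta>)"
      by (rule N[OF _ s])
    then show ?thesis
      by (simp add: f_def z_def contract_pow_add contract_pow_mult_pow C_def mult_ac)
  qed
  have "\<phi> (x + h) = \<phi> x" for x
  proof -
    have "\<bar>\<phi> (x + h) - \<phi> x\<bar> \<le> 2 * C * (cmod \<mu> * \<eta>) ^ n" for n
    proof -
      \<comment> \<open>enough steps for s to stay bounded, yet at most 2 |\<mu>|^n of them\<close>
      define m where "m = nat \<lceil>cmod \<mu> ^ n\<rceil>"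
      have pow1: "cmod \<mu> ^ n \<ge> 1" using \<mu>1 by simp
      then have m: "real m \<ge> cmod \<mu> ^ n" "real m \<le> 2 * cmod \<mu> ^ n" "m > 0"
        unfolding m_def by linarith+
      \<comment> \<open>the vector with M^(-n) s = h / m\<close>
      define s where "s = Re_vec ((of_real (1 / real m) * w * \<mu> ^ n) *s u)"
      have "norm s \<le> norm ((of_real (1 / real m) * w * \<mu> ^ n) *s u)"
        unfolding s_def by (rule norm_Re_vec_le)
      also have "\<dots> = cmod \<mu> ^ n / real m * norm (w *s u)"
        by (simp add: norm_vector_scale_complex norm_mult norm_power norm_divide)
      also have "\<dots> \<le> 1 * norm (w *s u)"
        using m by (intro mult_right_mono) auto
      finally have s: "norm s \<le> norm (w *s u)" by simp
      have "\<mu> \<noteq> 0" using \<mu>1 by auto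
      then have "(contract ^^ n) s = Re_vec ((of_real (1 / real m) * w) *s u)"
        unfolding s_def contract_def
        by (subst inverse_orbit_Re_eigenvector[OF det_nonzero _ u(2)]) auto
      also have "\<dots> = (1 / real m) *\<^sub>R h"
        by (simp add: h_def Re_vec_def vec_eq_iff)
      finally have "real m *\<^sub>R (contract ^^ n) s = h"
        using m by simp
      moreover have "\<bar>\<phi> (x + real m *\<^sub>R (contract ^^ n) s) - \<phi> x\<bar> \<le> real m * (C * \<eta> ^ n)"
        by (rule translation_steps) (rule step[OF s])
      ultimately have "\<bar>\<phi> (x + h) - \<phi> x\<bar> \<le> real m * (C * \<eta> ^ n)"
        by simp
      also have "\<dots> \<le> (2 * cmod \<mu> ^ n) * (C * \<eta> ^ n)"
        using m C0 \<eta>0 by (intro mult_right_mono) auto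
      finally show ?thesis by (simp add: power_mult_distrib mult_ac)
    qed
    moreover have "cmod \<mu> * \<eta> < 1"
    proof -
      have "0 < cmod \<mu>" using \<mu>1 by linarith
      from pos_less_divide_eq[OF this, of \<eta> 1] show ?thesis
        using \<eta>(2) by (simp only: mult.commute)
    qed
    ultimately show ?thesis
      using zero_if_geometric_bound[of "cmod \<mu> * \<eta>" "\<phi> (x + h) - \<phi> x" "2 * C"] \<eta>0 by simp
  qed
  then have "\<phi> = (\<lambda>x. 0)"
    using w by (intro periodic_bounded_support_imp_zero[OF bounded_support, of h]) (auto simp: h_def)
  with nz show False by contradiction
qed

definition directional_differences :: "complex ^ 's \<Rightarrow> (real ^ 'n) set" where
  "directional_differences u = {v y - v x | x y. x \<in> G \<and> y \<in> G \<and> y - x \<in> eigen_directions u}"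

lemma contract_eigen_directions:
  assumes "map_matrix of_int M *v u = \<mu> *s u" "\<mu> \<noteq> 0" "h \<in> eigen_directions u"
  shows "contract h \<in> eigen_directions u"
proof -
  obtain w where "h = Re_vec (w *s u)" using assms by (auto simp: eigen_directions_def)
  then have "contract h = Re_vec ((w / \<mu> ^ 1) *s u)"
    using inverse_orbit_Re_eigenvector[OF det_nonzero assms(2,1), of 1 w] by (simp add: contract_def)
  then show ?thesis by (simp add: eigen_directions_def)
qed

lemma directional_span_subset: "span (directional_differences u) \<subseteq> U"
  unfolding U_def difference_space_def directional_differences_def
  by (rule span_mono) blast

lemma directional_span_invariant:
  assumes u: "map_matrix of_int M *v u = \<mu> *s u" "\<mu> \<noteq> 0" and A: "A \<in> transitions"
  shows "A ` span (directional_differences u) \<subseteq> span (directional_differences u)"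
proof (rule transition_invariant_span[OF A])
  fix d s assume d: "d \<in> D" and "s \<in> directional_differences u"
  then obtain x y where xy: "s = v y - v x" "x \<in> G" "y \<in> G" "y - x \<in> eigen_directions u"
    by (auto simp: directional_differences_def)
  have "T d s = v (contract (real_vec d + y)) - v (contract (real_vec d + x))"
    using xy transition_difference by simp
  moreover have "contract (real_vec d + y) \<in> G" "contract (real_vec d + x) \<in> G"
    using d xy by (auto intro: digit_attractor_compose)
  moreover have "contract (real_vec d + y) - contract (real_vec d + x) = contract (y - x)"
    by (simp add: linear_diff[OF linear_contract, symmetric])
  then have "contract (real_vec d + y) - contract (real_vec d + x) \<in> eigen_directions u"
    using contract_eigen_directions[OF u xy(4)] by simp
  ultimately show "T d s \<in> span (directional_differences u)"
    unfolding directional_differences_def by (intro span_base) blast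
qed

text \<open>If all directional differences vanish, \<phi> is constant along the segments of direction h inside each
tile. Walking through the tiles makes h a period.\<close>

lemma directional_span_nonzero:
  assumes "u \<noteq> 0" and nz: "\<phi> \<noteq> (\<lambda>x. 0)"
  shows "span (directional_differences u) \<noteq> {0}"
proof
  assume zero: "span (directional_differences u) = {0}"
  obtain h where h: "h \<in> eigen_directions u" "h \<noteq> 0"
    using eigen_directions_nonzero[OF assms(1)] .
  have tile: "\<bar>\<phi> (real_vec k + g) - \<phi> (real_vec k + g')\<bar> \<le> 0"
    if g: "g \<in> G" "g' \<in> G" "g - g' = t *\<^sub>R h" for k g g' t
  proof -
    have "v g - v g' \<in> directional_differences u"
      using g scaleR_eigen_directions[OF h(1)] unfolding directional_differences_def by force
    then have "v g - v g' = 0"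
      using zero span_base by blast
    then show ?thesis
      using \<phi>_difference_le[OF g(1,2), of k] by simp
  qed
  obtain N :: nat where N: "\<And>(f :: real ^ 's \<Rightarrow> real) z s \<delta>. continuous_on UNIV f \<Longrightarrow> norm s \<le> norm h \<Longrightarrow>
    (\<forall>k. \<forall>g\<in>G. \<forall>g'\<in>G. (\<exists>t. g - g' = t *\<^sub>R s) \<longrightarrow> \<bar>f (real_vec k + g) - f (real_vec k + g')\<bar> \<le> \<delta>) \<Longrightarrow>
    \<bar>f (z + s) - f z\<bar> \<le> real N * \<delta>"
    using tilewise_oscillation_bound[of "norm h"] by blast
  have "\<bar>\<phi> (z + h) - \<phi> z\<bar> \<le> real N * 0" for z
    by (rule N[OF continuous_\<phi> order_refl]) (use tile in blast)
  then have "\<phi> = (\<lambda>x. 0)"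
    using h by (intro periodic_bounded_support_imp_zero[OF bounded_support, of h]) auto
  with nz show False by contradiction
qed

text \<open>A product of n operators applied to v(y) - v(x) is a difference of v over the displacement
M^(-n)(y - x), whose length is O(|\<mu>|^(-n)) for y - x in the eigendirections; the Lipschitz condition turns
this into a bound on the difference.\<close>

lemma joint_spectral_radius_le_if_directional:
  assumes u: "map_matrix of_int M *v u = \<mu> *s u" "\<mu> \<noteq> 0"
    and lip: "L-lipschitz_on UNIV \<phi>" and span: "U = span (directional_differences u)"
  shows "joint_spectral_radius U transitions \<le> 1 / cmod \<mu>"
proof (rule joint_spectral_radius_le_if_spanning_bound[OF _ span])
  show "0 \<le> 1 / cmod \<mu>" by simp
  fix e assume "e \<in> directional_differences u"
  then obtain x y where xy: "e = v y - v x" "x \<in> G" "y \<in> G" "y - x \<in> eigen_directions u"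
    by (auto simp: directional_differences_def)
  then obtain w where w: "y - x = Re_vec (w *s u)" by (auto simp: eigen_directions_def)
  define K where "K = real CARD('n) * (L * norm (w *s u))"
  have L: "L \<ge> 0" using lip lipschitz_on_nonneg by blast
  have "norm (foldr (\<circ>) As id e) \<le> K * (1 / cmod \<mu>) ^ length As" if As: "set As \<subseteq> transitions" for As
  proof -
    let ?n = "length As"
    obtain a where a: "\<And>g. g \<in> G \<Longrightarrow> foldr (\<circ>) As id (v g) = v ((contract ^^ ?n) g + a)"
      using product_shift_vector[OF As] by blast
    have "norm (foldr (\<circ>) As id e) = norm (v ((contract ^^ ?n) y + a) - v ((contract ^^ ?n) x + a))"
      unfolding xy(1) by (simp add: linear_diff[OF linear_product[OF As]] a xy)
    also have "\<dots> \<le> (\<Sum>i\<in>UNIV. \<bar>(v ((contract ^^ ?n) y + a) - v ((contract ^^ ?n) x + a)) $ i\<bar>)"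
      by (rule norm_le_l1_cart)
    also have "\<dots> \<le> (\<Sum>i\<in>(UNIV :: 'n set). L * norm ((contract ^^ ?n) (y - x)))"
    proof (rule sum_mono)
      fix i
      show "\<bar>(v ((contract ^^ ?n) y + a) - v ((contract ^^ ?n) x + a)) $ i\<bar> \<le> L * norm ((contract ^^ ?n) (y - x))"
        using lipschitz_onD[OF lip, of "(contract ^^ ?n) y + a + real_vec (\<omega> i)" "(contract ^^ ?n) x + a + real_vec (\<omega> i)"]
        by (simp add: shift_vector_def dist_norm contract_pow_diff)
    qed
    also have "\<dots> = real CARD('n) * (L * norm ((contract ^^ ?n) (y - x)))"
      by simp
    also have "\<dots> \<le> real CARD('n) * (L * ((1 / cmod \<mu>) ^ ?n * norm (w *s u)))"
    proof -
      have "norm ((contract ^^ ?n) (y - x)) \<le> norm ((w / \<mu> ^ ?n) *s u)"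
        unfolding w contract_def inverse_orbit_Re_eigenvector[OF det_nonzero u(2,1)]
        by (rule norm_Re_vec_le)
      also have "\<dots> = (1 / cmod \<mu>) ^ ?n * norm (w *s u)"
        by (simp add: norm_vector_scale_complex norm_divide norm_power power_divide)
      finally show ?thesis using L by (intro mult_left_mono) auto
    qed
    finally show ?thesis by (simp add: K_def mult_ac)
  qed
  then show "\<exists>K. \<forall>As. set As \<subseteq> transitions \<longrightarrow> norm (foldr (\<circ>) As id e) \<le> K * (1 / cmod \<mu>) ^ length As"
    by blast
qed

end

theorem corollary3:
  fixes M :: "int ^ 's ^ 's"
    and D :: "(int ^ 's) set"
    and c :: "int ^ 's \<Rightarrow> real"
    and \<phi> :: "real ^ 's \<Rightarrow> real"
    and \<omega> :: "'n::finite \<Rightarrow> int ^ 's"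
    and G K :: "(real ^ 's) set"
    and U :: "(real ^ 'n) set"
    and \<A> :: "(real ^ 'n \<Rightarrow> real ^ 'n) set"
  assumes "expansive M"
    and "\<bar>det M\<bar> \<ge> 2"
    and "complete_digits M D" and "0 \<in> D"
    and G_def: "G = digit_attractor M D"
    and "emeasure lebesgue G = 1"
    and "finite (seq_supp c)"
    and "sum_rule M D c"
    and K_def: "K = digit_attractor M (seq_supp c)"
    and "inj \<omega>" and "minimal_cover K G (range \<omega>)"
    and "refinable_function M c \<phi>"
    and U_def: "U = difference_space G \<phi> \<omega>"
    and A_def: "\<A> = (\<lambda>d. (*v) (transition_matrix M c \<omega> d)) ` D"
    and "anisotropic M"
    and "\<phi> \<noteq> (\<lambda>x. 0)"
    and "\<exists>L. L-lipschitz_on UNIV \<phi>"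
  shows "1 = holder_exponent \<phi>
       \<and> holder_exponent \<phi> > log_recip (spectral_radius M) (joint_spectral_radius U \<A>)
       \<and> reducible_on U \<A>"
proof -
  have det: "det M \<noteq> 0" using assms(2) by auto
  interpret R: continuous_refinable M D c \<phi> \<omega>
  proof
    show "expansive M" by fact
    show "det M \<noteq> 0" by (rule det)
    show "complete_digits M D" by fact
    show "0 \<in> D" by fact
    show "emeasure lebesgue (digit_attractor M D) = 1"
      using assms(6) unfolding G_def .
    show "finite (seq_supp c)" by fact
    show "inj \<omega>" by fact
    show "digit_attractor M (seq_supp c) \<subseteq> translates (range \<omega>) (digit_attractor M D)"
      using assms(11) unfolding minimal_cover_def G_def K_def by blast
    show "refinable_function M c \<phi>" by fact
  qed
  have U: "U = R.U" by (simp add: U_def R.U_def G_def)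
  have A: "\<A> = R.transitions" by (simp add: A_def R.transitions_def)
  define \<rho> where "\<rho> = joint_spectral_radius U \<A>"
  obtain L where L: "L-lipschitz_on UNIV \<phi>" using assms(17) by blast
  obtain z w where z: "z \<in> eigenvalues M" and w: "w \<in> eigenvalues M" and "cmod z < cmod w"
    using \<open>anisotropic M\<close> unfolding anisotropic_def by (metis linorder_neqE)
  then have z1: "1 < cmod z" and w1: "1 < cmod w"
    using \<open>expansive M\<close> by (auto simp: expansive_def)
  have less: "1 / cmod w < \<rho>"
  proof -
    \<comment> \<open>the smaller eigenvalue is the slow direction that forces the spectral radius up\<close>
    have "1 / cmod w < 1 / cmod z"
      using \<open>cmod z < cmod w\<close> z1 by (intro divide_strict_left_mono mult_pos_pos) linarith+
    also have "\<dots> \<le> \<rho>"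
      unfolding \<rho>_def U A by (rule R.joint_spectral_radius_ge[OF z assms(16)])
    finally show ?thesis .
  qed
  have holder: "holder_exponent \<phi> = 1"
    by (rule holder_exponent_Lipschitz[OF L R.bounded_support assms(16)])
  have "log_recip (spectral_radius M) \<rho> < 1"
  proof -
    let ?r = "spectral_radius M"
    have r: "cmod w \<le> ?r" by (rule cmod_eigenvalue_le_spectral_radius[OF w])
    have "0 < ?r" and "1 < ?r" using r w1 by linarith+
    have "1 / ?r \<le> 1 / cmod w"
      using r w1 by (intro divide_left_mono mult_pos_pos) linarith+
    then have "1 / ?r < \<rho>" using less by linarith
    moreover have pos: "0 < 1 / ?r" using \<open>0 < ?r\<close> by simp
    ultimately have "0 < \<rho>" by linarith
    then have "ln (1 / ?r) < ln \<rho>" and "\<rho> \<noteq> 0"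
      using iffD2[OF ln_less_cancel_iff[OF pos] \<open>1 / ?r < \<rho>\<close>] by simp_all
    moreover have "ln (1 / ?r) = - ln ?r" "0 < ln ?r"
      using \<open>1 < ?r\<close> by (simp_all add: ln_div)
    ultimately have "- ln \<rho> < ln ?r" "0 < ln ?r" by linarith+
    then have "- ln \<rho> / ln ?r < 1" by (simp only: divide_less_eq_1_pos)
    then show ?thesis
      using \<open>\<rho> \<noteq> 0\<close> by (simp add: log_recip_def one_ereal_def)
  qed
  moreover have "reducible_on U \<A>"
  proof -
    obtain u where u: "u \<noteq> 0" "map_matrix of_int M *v u = w *s u"
      using w by (auto simp: eigenvalues_def)
    have w0: "w \<noteq> 0" using w1 by auto
    \<comment> \<open>the larger eigenvalue gives the fast directions\<close>
    let ?W = "span (R.directional_differences u)"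
    have "?W \<noteq> U"
    proof
      assume "?W = U"
      then have "\<rho> \<le> 1 / cmod w"
        unfolding \<rho>_def U A by (intro R.joint_spectral_radius_le_if_directional[OF u(2) w0 L]) simp
      with less show False by linarith
    qed
    moreover have "?W \<subseteq> U" unfolding U by (rule R.directional_span_subset)
    moreover have "?W \<noteq> {0}" by (rule R.directional_span_nonzero[OF u(1) assms(16)])
    moreover have "\<forall>A\<in>\<A>. A ` ?W \<subseteq> ?W"
      unfolding A using R.directional_span_invariant[OF u(2) w0] by blast
    ultimately show ?thesis
      unfolding reducible_on_def by (intro exI[of _ ?W]) simp
  qed
  ultimately show ?thesis
    using holder by (simp add: \<rho>_def)
qed

end
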